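(* Let $G$ be a finite group and let $k \geqslant \max\{d_G(G),2\}$ be an integer. Then two tuples $U,V \in N_k(G)$ are AC-equivalent in $G$ if and only if their images (taken componentwise) in the abelianisation $\mathrm{Ab}(G)=G/[G,G]$ are AC-equivalent in $\mathrm{Ab}(G)$; i.e., the connected components of the Andrews–Curtis graph $\Delta_k(G)$ are precisely the preimages, under the componentwise map $N_k(G)\to N_k(\mathrm{Ab}(G))$, of the connected components of the Andrews–Curtis graph $\Delta_k(\mathrm{Ab}(G))$.
   Context: For a group $G$ and $Y\subseteq G$, $gp_G(Y)$ denotes the normal closure of $Y$ in $G$, and $d_G(G)$ denotes the minimal number of elements generating $G$ as a normal subgroup of itself. $N_k(G)=\{(g_1,\ldots,g_k)\in G^k \mid gp_G(g_1,\ldots,g_k)=G\}$. The elementary AC-moves (Andrews–Curtis transformations) on $G^k$ are the following, each changing only the $i$-th component of a tuple $(x_1,\ldots,x_k)$: (1) $x_i\mapsto x_ix_j^{\pm1}$ with $j\ne i$; (2) $x_i\mapsto x_j^{\pm1}x_i$ with $j\neq i$; (3) $x_i\mapsto x_i^{-1}$; (4) $x_i\mapsto x_i^{w}=w^{-1}x_iw$ with $w\in G$. These moves preserve $N_k(G)$. Two $k$-tuples are AC-equivalent in $G$ if a finite sequence of AC-moves transforms one into the other. The Andrews–Curtis graph $\Delta_k(G)$ has vertex set $N_k(G)$, with two vertices joined by an edge if one is obtained from the other by an elementary AC-move. The same definitions are applied to the group $\mathrm{Ab}(G)$. *)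

theory Defs
  imports "HOL-Algebra.Generated_Groups" "Graph_Theory.Digraph_Component"
begin

definition normal_closure :: "('a, 'b) monoid_scheme \<Rightarrow> 'a set \<Rightarrow> 'a set" where
  "normal_closure G Y = \<Inter>{N. N \<lhd> G \<and> Y \<subseteq> N}"

text \<open>The number written \<open>d_G(G)\<close> in the literature. It is meaningful only if \<open>G\<close> is
  generated, as a normal subgroup of itself, by some finite set; this holds for finite \<open>G\<close>.\<close>

definition normal_rank :: "('a, 'b) monoid_scheme \<Rightarrow> nat" where
  "normal_rank G = (LEAST d. \<exists>Y. Y \<subseteq> carrier G \<and> finite Y \<and> card Y = d \<and>
     normal_closure G Y = carrier G)"

text \<open>A \<open>k\<close>-tuple over \<open>G\<close> is a list of length \<open>k\<close>, with components numbered from 0.\<close>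

definition normal_generating_tuples :: "('a, 'b) monoid_scheme \<Rightarrow> nat \<Rightarrow> 'a list set" where
  "normal_generating_tuples G k =
     {xs. length xs = k \<and> set xs \<subseteq> carrier G \<and> normal_closure G (set xs) = carrier G}"

inductive AC_move :: "('a, 'b) monoid_scheme \<Rightarrow> 'a list \<Rightarrow> 'a list \<Rightarrow> bool" for G where
  mult_right: "\<lbrakk>i < length xs; j < length xs; j \<noteq> i\<rbrakk>
     \<Longrightarrow> AC_move G xs (xs[i := xs ! i \<otimes>\<^bsub>G\<^esub> xs ! j])"
| mult_right_inv: "\<lbrakk>i < length xs; j < length xs; j \<noteq> i\<rbrakk>
     \<Longrightarrow> AC_move G xs (xs[i := xs ! i \<otimes>\<^bsub>G\<^esub> inv\<^bsub>G\<^esub> (xs ! j)])"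
| mult_left: "\<lbrakk>i < length xs; j < length xs; j \<noteq> i\<rbrakk>
     \<Longrightarrow> AC_move G xs (xs[i := xs ! j \<otimes>\<^bsub>G\<^esub> xs ! i])"
| mult_left_inv: "\<lbrakk>i < length xs; j < length xs; j \<noteq> i\<rbrakk>
     \<Longrightarrow> AC_move G xs (xs[i := inv\<^bsub>G\<^esub> (xs ! j) \<otimes>\<^bsub>G\<^esub> xs ! i])"
| invert: "i < length xs \<Longrightarrow> AC_move G xs (xs[i := inv\<^bsub>G\<^esub> (xs ! i)])"
| conjugate: "\<lbrakk>i < length xs; w \<in> carrier G\<rbrakk>
     \<Longrightarrow> AC_move G xs (xs[i := inv\<^bsub>G\<^esub> w \<otimes>\<^bsub>G\<^esub> xs ! i \<otimes>\<^bsub>G\<^esub> w])"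

definition AC_equivalent :: "('a, 'b) monoid_scheme \<Rightarrow> 'a list \<Rightarrow> 'a list \<Rightarrow> bool" where
  "AC_equivalent G = (AC_move G)\<^sup>*\<^sup>*"

text \<open>Undirected edges are represented by pairs of opposite arcs. Moves that fix a tuple give
  loops, which do not affect connectedness.\<close>

definition AC_graph :: "('a, 'b) monoid_scheme \<Rightarrow> nat \<Rightarrow> 'a list pair_pre_digraph" where
  "AC_graph G k =
     \<lparr> pverts = normal_generating_tuples G k,
       parcs = {(U, V). U \<in> normal_generating_tuples G k \<and> V \<in> normal_generating_tuples G k \<and>
                        (AC_move G U V \<or> AC_move G V U)} \<rparr>"

text \<open>The arc relation of \<open>AC_graph\<close> is symmetric, so its strongly connected components are
  its connected components; each is given by its vertex set.\<close>

definition AC_components :: "('a, 'b) monoid_scheme \<Rightarrow> nat \<Rightarrow> 'a list set set" where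
  "AC_components G k = pre_digraph.sccs_verts (with_proj (AC_graph G k))"

definition abelianisation :: "('a, 'b) monoid_scheme \<Rightarrow> 'a set monoid" where
  "abelianisation G = G Mod derived G (carrier G)"

definition abelianisation_map :: "('a, 'b) monoid_scheme \<Rightarrow> 'a \<Rightarrow> 'a set" where
  "abelianisation_map G x = derived G (carrier G) #>\<^bsub>G\<^esub> x"

end

theory Submission
  imports Defs "HOL-Algebra.Weak_Morphisms"
begin

text \<open>
  Moves commute with homomorphisms, and along a surjection every move downstairs lifts to a move
  upstairs. Hence the equivalence of tuples in \<open>Ab(G)\<close> says that some tuple equivalent to \<open>U\<close> agrees
  with \<open>V\<close> modulo the derived subgroup \<open>G'\<close>, and the heart of the matter is
  \<open>AC_equivalent_if_congruent_mod_derived\<close>: normally generating tuples that agree modulo \<open>G'\<close> are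
  equivalent. The basic tool is \<open>AC_mult_normal_closure\<close>: a component may be multiplied by any
  element of the normal closure of the other components.

  The proof is by induction on \<open>|G|\<close>. If \<open>G\<close> is abelian there is nothing to do. Otherwise it is enough
  to find, for a given tuple \<open>xs\<close>, a minimal normal subgroup \<open>L \<le> G'\<close> such that \<open>xs\<close> is equivalent to
  every normally generating tuple congruent to it modulo \<open>L\<close>: by induction \<open>ys\<close> is equivalent in
  \<open>G/L\<close> to \<open>xs\<close>, so lifting the moves shows that \<open>ys\<close> is equivalent to a tuple congruent to \<open>xs\<close>
  modulo \<open>L\<close>.

  If \<open>L\<close> is not central, then any element that does not centralise \<open>L\<close> has \<open>L\<close> in its normal closure,
  and a normally generating tuple has a component of this kind; it lets all other components be
  changed modulo \<open>L\<close>. As \<open>k \<ge> 2\<close>, two such components in different positions can be arranged, which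
  takes care of every position
  (\<open>AC_equivalent_mod_noncentral_minimal_normal\<close>).

  If all minimal normal subgroups inside \<open>G'\<close> are central, choose a noncentral component \<open>x\<close> and put
  \<open>P = [\<langle>x\<rangle>, G]\<close> and \<open>R = [M, G]\<close>, where \<open>\<langle>x\<rangle>\<close> and \<open>M\<close> are the normal closures of \<open>x\<close> and of the other
  components. These commutator subgroups do not change when the components are multiplied by
  central elements. A minimal normal \<open>L \<le> P\<close> lies in the normal closure of \<open>x\<close>, so all components but
  \<open>x\<close> can be changed modulo \<open>L\<close>; only \<open>x\<close> itself needs care. If \<open>P \<inter> R \<noteq> 1\<close>, choose \<open>L\<close> in it, and \<open>x\<close>
  can be changed because \<open>L \<le> M\<close>. If \<open>P \<inter> R = 1\<close>, then the other components commute with all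
  conjugates of \<open>x\<close>, which forces some \<open>y \<in> P\<close> not to commute with some conjugate \<open>z\<close> of \<open>x\<close>. Multiply
  another component \<open>u\<close> by \<open>y\<close>: the commutator \<open>[u y, z] \<noteq> 1\<close> lies both in \<open>P\<close> and in the normal
  closure of \<open>u y\<close>, and \<open>L\<close> is chosen inside its normal closure. Now \<open>x\<close> can be changed modulo \<open>L\<close>,
  after which \<open>u y\<close> is turned back into \<open>u\<close>
  (\<open>AC_equivalent_mod_some_central_subgroup\<close>).

  For the statement on components it remains to see that every component of the graph of \<open>Ab(G)\<close>
  has a nonempty preimage. This is \<open>normal_generating_tuple_lift\<close>: a nonempty tuple that normally
  generates \<open>G\<close> together with \<open>G'\<close> can be corrected modulo \<open>G'\<close> so that it normally generates \<open>G\<close>.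
\<close>

section \<open>Normal closures and centralisers\<close>

context group
begin

lemma mult_inv_cancel_left:
  assumes "x \<in> carrier G" "y \<in> carrier G"
  shows "x \<otimes> (inv x \<otimes> y) = y" "inv x \<otimes> (x \<otimes> y) = y"
  using assms by (simp_all flip: m_assoc)

lemma normal_closure_normal:
  assumes "Y \<subseteq> carrier G"
  shows "normal_closure G Y \<lhd> G"
proof -
  have ne: "{N. N \<lhd> G \<and> Y \<subseteq> N} \<noteq> {}"
    using assms normal_self by blast
  have "subgroup (normal_closure G Y) G"
    unfolding normal_closure_def using ne by (intro subgroups_Inter) (auto dest: normal_imp_subgroup)
  then show ?thesis
    by (rule normal_invI) (auto simp: normal_closure_def dest: normal.inv_op_closed2)
qed

lemma normal_closure_least: "N \<lhd> G \<Longrightarrow> Y \<subseteq> N \<Longrightarrow> normal_closure G Y \<subseteq> N"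
  by (auto simp: normal_closure_def)

lemma subset_normal_closure: "Y \<subseteq> normal_closure G Y"
  by (auto simp: normal_closure_def)

lemma normal_closure_mono: "X \<subseteq> Y \<Longrightarrow> normal_closure G X \<subseteq> normal_closure G Y"
  by (auto simp: normal_closure_def)

lemma normal_subset_carrier: "N \<lhd> G \<Longrightarrow> N \<subseteq> carrier G"
  by (simp add: normal_imp_subgroup subgroup.subset)

lemma normal_generating_normal_eq:
  assumes "xs \<in> normal_generating_tuples G k" "N \<lhd> G" "set xs \<subseteq> N"
  shows "N = carrier G"
proof
  show "carrier G \<subseteq> N"
    using assms(1) normal_closure_least[OF assms(2,3)] by (simp add: normal_generating_tuples_def)
qed (rule normal_subset_carrier[OF assms(2)])

lemma centraliser_normal:
  assumes S: "S \<subseteq> carrier G"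
    and conj: "\<And>g s. g \<in> carrier G \<Longrightarrow> s \<in> S \<Longrightarrow> inv g \<otimes> s \<otimes> g \<in> S"
  shows "{g \<in> carrier G. \<forall>s\<in>S. g \<otimes> s = s \<otimes> g} \<lhd> G" (is "?C \<lhd> G")
proof (rule normal_invI)
  show "subgroup ?C G"
  proof
    fix g h assume g: "g \<in> ?C" and h: "h \<in> ?C"
    have "g \<otimes> h \<otimes> s = s \<otimes> (g \<otimes> h)" if "s \<in> S" for s
    proof -
      have c: "s \<in> carrier G" "g \<in> carrier G" "h \<in> carrier G" using g h that S by auto
      have "g \<otimes> h \<otimes> s = g \<otimes> (s \<otimes> h)" using c h that by (simp add: m_assoc)
      also have "\<dots> = s \<otimes> (g \<otimes> h)" using c g that by (simp flip: m_assoc)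
      finally show ?thesis .
    qed
    then show "g \<otimes> h \<in> ?C" using g h by auto
  next
    fix g assume g: "g \<in> ?C"
    have "inv g \<otimes> s = s \<otimes> inv g" if "s \<in> S" for s
    proof -
      have c: "s \<in> carrier G" "g \<in> carrier G" using g that S by auto
      have "s = inv g \<otimes> (g \<otimes> s)" using c by (simp flip: m_assoc)
      also have "\<dots> = inv g \<otimes> s \<otimes> g" using c g that by (simp add: m_assoc)
      finally show ?thesis using c by (metis inv_closed inv_solve_right m_closed)
    qed
    then show "inv g \<in> ?C" using g by auto
  qed (use S in auto)
next
  fix x g assume x: "x \<in> carrier G" and g: "g \<in> ?C"
  have "x \<otimes> g \<otimes> inv x \<otimes> s = s \<otimes> (x \<otimes> g \<otimes> inv x)" if s: "s \<in> S" for s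
  proof -
    have c: "s \<in> carrier G" "g \<in> carrier G" using g s S by auto
    have *: "g \<otimes> (inv x \<otimes> s \<otimes> x) = (inv x \<otimes> s \<otimes> x) \<otimes> g"
      using g conj[OF x s] by auto
    have "x \<otimes> g \<otimes> inv x \<otimes> s = x \<otimes> (g \<otimes> (inv x \<otimes> s \<otimes> x)) \<otimes> inv x"
      using c x by (simp add: m_assoc)
    also note *
    also have "x \<otimes> ((inv x \<otimes> s \<otimes> x) \<otimes> g) \<otimes> inv x = x \<otimes> inv x \<otimes> s \<otimes> (x \<otimes> g \<otimes> inv x)"
      using c x by (simp only: m_assoc m_closed inv_closed)
    also have "\<dots> = s \<otimes> (x \<otimes> g \<otimes> inv x)"
      using c x by simp
    finally show ?thesis .
  qed
  then show "x \<otimes> g \<otimes> inv x \<in> ?C" using x g by auto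
qed

lemma normal_conj:
  assumes "N \<lhd> G" "n \<in> N" "g \<in> carrier G"
  shows "inv g \<otimes> n \<otimes> g \<in> N" "g \<otimes> n \<otimes> inv g \<in> N"
  using assms by (auto intro: normal.inv_op_closed1 normal.inv_op_closed2)

lemma normal_centraliser_normal:
  assumes "N \<lhd> G"
  shows "{g \<in> carrier G. \<forall>n\<in>N. g \<otimes> n = n \<otimes> g} \<lhd> G"
  using assms by (intro centraliser_normal normal_subset_carrier normal_conj(1))

end

section \<open>Andrews--Curtis moves\<close>

context group
begin

lemma AC_move_length: "AC_move G xs ys \<Longrightarrow> length ys = length xs"
  by (induction rule: AC_move.induct) auto

text \<open>Used for \<open>N = carrier G\<close> and for the normal closure of the tuple.\<close>

lemma AC_move_subset_normal:
  assumes move: "AC_move G xs ys" and N: "N \<lhd> G" and xs: "set xs \<subseteq> N"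
  shows "set ys \<subseteq> N"
proof -
  interpret N: normal N G by (rule N)
  have nth: "xs ! i \<in> N" if "i < length xs" for i using xs that by auto
  have upd: "set (xs[i := x]) \<subseteq> N" if "x \<in> N" for i x using xs that by (rule set_update_subsetI)
  show ?thesis
    using move
    by cases (auto intro!: upd N.inv_op_closed1 nth simp del: set_list_update simp only:)
qed

lemma AC_move_closed: "AC_move G xs ys \<Longrightarrow> set xs \<subseteq> carrier G \<Longrightarrow> set ys \<subseteq> carrier G"
  using AC_move_subset_normal normal_self by blast

lemma AC_move_sym:
  assumes "AC_move G xs ys" "set xs \<subseteq> carrier G"
  shows "AC_move G ys xs"
  using assms
proof (induction rule: AC_move.induct)
  case (mult_right i xs j)
  then have c: "xs ! i \<in> carrier G" "xs ! j \<in> carrier G" by auto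
  then show ?case using AC_move.mult_right_inv[of i "xs[i := xs ! i \<otimes> xs ! j]" j G] mult_right
    by (simp add: m_assoc)
next
  case (mult_right_inv i xs j)
  then have c: "xs ! i \<in> carrier G" "xs ! j \<in> carrier G" by auto
  then show ?case using AC_move.mult_right[of i "xs[i := xs ! i \<otimes> inv (xs ! j)]" j G] mult_right_inv
    by (simp add: m_assoc)
next
  case (mult_left i xs j)
  then have c: "xs ! i \<in> carrier G" "xs ! j \<in> carrier G" by auto
  then show ?case using AC_move.mult_left_inv[of i "xs[i := xs ! j \<otimes> xs ! i]" j G] mult_left
    by (simp flip: m_assoc)
next
  case (mult_left_inv i xs j)
  then have c: "xs ! i \<in> carrier G" "xs ! j \<in> carrier G" by auto
  then show ?case using AC_move.mult_left[of i "xs[i := inv (xs ! j) \<otimes> xs ! i]" j G] mult_left_inv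
    by (simp flip: m_assoc)
next
  case (invert i xs)
  then have c: "xs ! i \<in> carrier G" by auto
  then show ?case using AC_move.invert[of i "xs[i := inv (xs ! i)]" G] invert by simp
next
  case (conjugate i xs w)
  then have c: "xs ! i \<in> carrier G" by auto
  have "w \<otimes> (inv w \<otimes> xs ! i \<otimes> w) \<otimes> inv w = (w \<otimes> inv w) \<otimes> xs ! i \<otimes> (w \<otimes> inv w)"
    using c conjugate by (simp only: m_assoc m_closed inv_closed)
  then show ?case using AC_move.conjugate[of i "xs[i := inv w \<otimes> xs ! i \<otimes> w]" "inv w" G] c conjugate
    by simp
qed

lemma AC_move_normal_closure_subset:
  assumes "AC_move G xs ys" "set xs \<subseteq> carrier G"
  shows "normal_closure G (set ys) \<subseteq> normal_closure G (set xs)"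
proof -
  let ?N = "normal_closure G (set xs)"
  have N: "?N \<lhd> G" by (rule normal_closure_normal[OF assms(2)])
  have "set ys \<subseteq> ?N"
    using assms(1) N subset_normal_closure by (rule AC_move_subset_normal)
  then show ?thesis by (rule normal_closure_least[OF N])
qed

lemma AC_move_normal_generating:
  assumes "AC_move G xs ys" "xs \<in> normal_generating_tuples G k"
  shows "ys \<in> normal_generating_tuples G k"
proof -
  have xs: "set xs \<subseteq> carrier G" using assms(2) by (simp add: normal_generating_tuples_def)
  have ys: "set ys \<subseteq> carrier G" using assms(1) xs by (rule AC_move_closed)
  have "normal_closure G (set ys) = normal_closure G (set xs)"
    using AC_move_normal_closure_subset[OF assms(1) xs]
      AC_move_normal_closure_subset[OF AC_move_sym[OF assms(1) xs] ys] by blast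
  then show ?thesis
    using assms ys AC_move_length by (auto simp: normal_generating_tuples_def)
qed

lemma AC_equivalent_refl: "AC_equivalent G xs xs"
  by (simp add: AC_equivalent_def)

lemma AC_move_imp_equivalent: "AC_move G xs ys \<Longrightarrow> AC_equivalent G xs ys"
  by (simp add: AC_equivalent_def)

lemma AC_equivalent_trans [trans]:
  "AC_equivalent G xs ys \<Longrightarrow> AC_equivalent G ys zs \<Longrightarrow> AC_equivalent G xs zs"
  by (simp add: AC_equivalent_def)

lemma AC_equivalent_closed:
  assumes "AC_equivalent G xs ys" "set xs \<subseteq> carrier G"
  shows "set ys \<subseteq> carrier G"
  using assms unfolding AC_equivalent_def
  by (induction rule: rtranclp_induct) (auto dest: AC_move_closed)

lemma AC_equivalent_normal_generating:
  assumes "AC_equivalent G xs ys" "xs \<in> normal_generating_tuples G k"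
  shows "ys \<in> normal_generating_tuples G k"
  using assms unfolding AC_equivalent_def
  by (induction rule: rtranclp_induct) (auto dest: AC_move_normal_generating)

lemma AC_equivalent_sym:
  assumes "AC_equivalent G xs ys" "set xs \<subseteq> carrier G"
  shows "AC_equivalent G ys xs"
  using assms(1) unfolding AC_equivalent_def
proof (induction rule: rtranclp_induct)
  case (step ys zs)
  then have "set ys \<subseteq> carrier G"
    using AC_equivalent_closed assms(2) by (simp add: AC_equivalent_def)
  then show ?case using step AC_move_sym by (metis converse_rtranclp_into_rtranclp)
qed simp

end

section \<open>Changing components modulo a normal subgroup\<close>

definition other_components :: "'a list \<Rightarrow> nat \<Rightarrow> 'a set" where
  "other_components xs i = {xs ! j | j. j < length xs \<and> j \<noteq> i}"

lemma nth_in_other_components: "j < length xs \<Longrightarrow> j \<noteq> i \<Longrightarrow> xs ! j \<in> other_components xs i"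
  by (auto simp: other_components_def)

lemma other_components_subset: "other_components xs i \<subseteq> set xs"
  by (auto simp: other_components_def)

context group
begin

text \<open>The elements \<open>y\<close> by which the \<open>i\<close>-th component may be multiplied, whatever its value \<open>x\<close>, form a
  normal subgroup: conjugate \<open>x\<close> by \<open>w\<close>, multiply by \<open>y\<close> and conjugate back to multiply \<open>x\<close> by
  \<open>w y w\<^sup>-\<^sup>1\<close>. It contains the other components. The quantification over all \<open>x\<close> is what makes this
  set closed under products and conjugation.\<close>

lemma AC_mult_normal_closure:
  assumes xs: "set xs \<subseteq> carrier G" and i: "i < length xs"
    and y: "y \<in> normal_closure G (other_components xs i)" and x: "x \<in> carrier G"
  shows "AC_equivalent G (xs[i := x]) (xs[i := x \<otimes> y])"
proof -
  let ?S = "{y \<in> carrier G. \<forall>x\<in>carrier G. AC_equivalent G (xs[i := x]) (xs[i := x \<otimes> y])}"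
  have upd: "set (xs[i := x]) \<subseteq> carrier G" if "x \<in> carrier G" for x
    using xs that by (meson set_update_subsetI)
  have conj: "AC_equivalent G (xs[i := x]) (xs[i := inv w \<otimes> x \<otimes> w])"
    if "w \<in> carrier G" for w x
    using AC_move.conjugate[of i "xs[i := x]" w G] i that by (simp add: AC_move_imp_equivalent)
  have "subgroup ?S G"
  proof
    fix a b assume a: "a \<in> ?S" and b: "b \<in> ?S"
    have "AC_equivalent G (xs[i := x]) (xs[i := x \<otimes> (a \<otimes> b)])" if "x \<in> carrier G" for x
    proof -
      have "AC_equivalent G (xs[i := x]) (xs[i := x \<otimes> a])" using a that by auto
      also have "AC_equivalent G (xs[i := x \<otimes> a]) (xs[i := x \<otimes> a \<otimes> b])" using a b that by auto
      finally show ?thesis using a b that by (simp add: m_assoc)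
    qed
    then show "a \<otimes> b \<in> ?S" using a b by auto
  next
    fix a assume a: "a \<in> ?S"
    have "AC_equivalent G (xs[i := x]) (xs[i := x \<otimes> inv a])" if "x \<in> carrier G" for x
    proof -
      have "AC_equivalent G (xs[i := x \<otimes> inv a]) (xs[i := x \<otimes> inv a \<otimes> a])" using a that by auto
      moreover have "x \<otimes> inv a \<otimes> a = x" using a that by (simp add: m_assoc)
      moreover have "set (xs[i := x \<otimes> inv a]) \<subseteq> carrier G" using a that by (intro upd) simp
      ultimately show ?thesis using AC_equivalent_sym by metis
    qed
    then show "inv a \<in> ?S" using a by auto
  qed (auto simp: AC_equivalent_refl)
  then have "?S \<lhd> G"
  proof (rule normal_invI)
    fix w a assume w: "w \<in> carrier G" and a: "a \<in> ?S"
    have "AC_equivalent G (xs[i := x]) (xs[i := x \<otimes> (w \<otimes> a \<otimes> inv w)])" if x: "x \<in> carrier G" for x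
    proof -
      have "AC_equivalent G (xs[i := x]) (xs[i := inv w \<otimes> x \<otimes> w])" using conj w .
      also have "AC_equivalent G (xs[i := inv w \<otimes> x \<otimes> w]) (xs[i := inv w \<otimes> x \<otimes> w \<otimes> a])"
        using a w x by auto
      also have "AC_equivalent G (xs[i := inv w \<otimes> x \<otimes> w \<otimes> a])
          (xs[i := inv (inv w) \<otimes> (inv w \<otimes> x \<otimes> w \<otimes> a) \<otimes> inv w])"
        using conj w by blast
      also have "inv (inv w) \<otimes> (inv w \<otimes> x \<otimes> w \<otimes> a) \<otimes> inv w
          = (w \<otimes> inv w) \<otimes> x \<otimes> (w \<otimes> a \<otimes> inv w)"
        using a w x by (simp only: m_assoc m_closed inv_closed inv_inv mem_Collect_eq)
      finally show ?thesis using w x by simp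
    qed
    then show "w \<otimes> a \<otimes> inv w \<in> ?S" using w a by auto
  qed
  moreover have "other_components xs i \<subseteq> ?S"
  proof
    fix y assume "y \<in> other_components xs i"
    then obtain j where j: "y = xs ! j" "j < length xs" "j \<noteq> i" by (auto simp: other_components_def)
    have "AC_equivalent G (xs[i := x]) (xs[i := x \<otimes> y])" for x
      using AC_move.mult_right[of i "xs[i := x]" j G] i j by (simp add: AC_move_imp_equivalent)
    then show "y \<in> ?S" using j xs by auto
  qed
  ultimately show ?thesis
    using normal_closure_least[of ?S "other_components xs i"] x y by blast
qed

lemma AC_change_component:
  assumes xs: "set xs \<subseteq> carrier G" and i: "i < length xs"
    and N: "N \<subseteq> normal_closure G (other_components xs i)" and xy: "(x, y) \<in> rcong N"
  shows "AC_equivalent G (xs[i := x]) (xs[i := y])"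
proof -
  have c: "x \<in> carrier G" "y \<in> carrier G" "inv x \<otimes> y \<in> N" using xy by (auto simp: r_congruent_def)
  then have "AC_equivalent G (xs[i := x]) (xs[i := x \<otimes> (inv x \<otimes> y)])"
    using N by (intro AC_mult_normal_closure[OF xs i]) auto
  also have "x \<otimes> (inv x \<otimes> y) = y" using c by (simp flip: m_assoc)
  finally show ?thesis .
qed

text \<open>The component \<open>xs ! i\<close> is never touched, so its normal closure stays available while the other
  components are replaced one after the other; after \<open>m\<close> steps the tuple is
  \<open>take m ys @ drop m xs\<close>.\<close>

lemma AC_change_other_components:
  assumes cong: "list_all2 (\<lambda>x y. (x, y) \<in> rcong N) xs ys"
    and i: "i < length xs" "xs ! i = ys ! i"
    and N: "N \<subseteq> normal_closure G {xs ! i}"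
  shows "AC_equivalent G xs ys"
proof -
  have len: "length ys = length xs" using cong by (simp add: list_all2_lengthD)
  have xsc: "set xs \<subseteq> carrier G" and ysc: "set ys \<subseteq> carrier G"
    using cong by (auto simp: list_all2_conv_all_nth r_congruent_def in_set_conv_nth)
  have "AC_equivalent G xs (take m ys @ drop m xs)" if "m \<le> length xs" for m
    using that
  proof (induction m)
    case (Suc m)
    let ?zs = "take m ys @ drop m xs"
    have zsc: "set ?zs \<subseteq> carrier G"
      using xsc ysc set_take_subset[of m ys] set_drop_subset[of m xs] by auto
    have zl: "length ?zs = length xs" using Suc.prems len by simp
    have zm: "?zs ! m = xs ! m" using Suc.prems len by (simp add: nth_append)
    have zi: "?zs ! i = xs ! i" using Suc.prems len i by (simp add: nth_append)
    have upd: "?zs[m := ys ! m] = take (Suc m) ys @ drop (Suc m) xs"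
      using Suc.prems len
      by (intro nth_equalityI) (auto simp: nth_append nth_list_update less_Suc_eq)
    have "AC_equivalent G ?zs (?zs[m := ys ! m])"
    proof (cases "m = i")
      case True
      then show ?thesis using i zm by (metis AC_equivalent_refl list_update_id)
    next
      case False
      have "N \<subseteq> normal_closure G (other_components ?zs m)"
        using N normal_closure_mono[of "{xs ! i}" "other_components ?zs m"]
          nth_in_other_components[of i ?zs m] zi zl i False by auto
      moreover have "(xs ! m, ys ! m) \<in> rcong N"
        using cong Suc.prems by (auto simp: list_all2_conv_all_nth)
      ultimately have "AC_equivalent G (?zs[m := xs ! m]) (?zs[m := ys ! m])"
        using Suc.prems zl by (intro AC_change_component[OF zsc]) auto
      then show ?thesis by (metis list_update_id zm)
    qed
    then show ?case using Suc AC_equivalent_trans upd by (metis Suc_leD)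
  qed (simp add: AC_equivalent_refl)
  from this[of "length xs"] show ?thesis using len by simp
qed

end


section \<open>Commutators and minimal normal subgroups\<close>

text \<open>This is \<open>[N, G]\<close> for the normal closure \<open>N\<close> of \<open>X\<close>. Defining it by the commutators of the elements of
  \<open>X\<close> alone makes it evident that it depends on \<open>X\<close> only modulo the centre.\<close>

definition commutator_closure :: "('a, 'b) monoid_scheme \<Rightarrow> 'a set \<Rightarrow> 'a set" where
  "commutator_closure G X = normal_closure G
     {x \<otimes>\<^bsub>G\<^esub> g \<otimes>\<^bsub>G\<^esub> inv\<^bsub>G\<^esub> x \<otimes>\<^bsub>G\<^esub> inv\<^bsub>G\<^esub> g | x g. x \<in> X \<and> g \<in> carrier G}"

definition minimal_normal :: "('a, 'b) monoid_scheme \<Rightarrow> 'a set \<Rightarrow> bool" where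
  "minimal_normal G L \<longleftrightarrow> L \<lhd> G \<and> L \<noteq> {\<one>\<^bsub>G\<^esub>} \<and> (\<forall>N. N \<lhd> G \<and> N \<subseteq> L \<longrightarrow> N = {\<one>\<^bsub>G\<^esub>} \<or> N = L)"

context group
begin

lemma comm_mem_normal:
  assumes "N \<lhd> G" "x \<in> carrier G" "y \<in> carrier G" "x \<in> N \<or> y \<in> N"
  shows "x \<otimes> y \<otimes> inv x \<otimes> inv y \<in> N"
proof -
  interpret N: normal N G by (rule assms)
  show ?thesis
  proof (cases "x \<in> N")
    case True
    have "x \<otimes> (y \<otimes> inv x \<otimes> inv y) \<in> N" using True assms by (intro N.m_closed N.inv_op_closed2) auto
    then show ?thesis using assms by (simp add: m_assoc)
  next
    case False
    then have "(x \<otimes> y \<otimes> inv x) \<otimes> inv y \<in> N" using assms by (intro N.m_closed N.inv_op_closed2) auto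
    then show ?thesis .
  qed
qed

lemma comm_eq_one_iff:
  assumes "x \<in> carrier G" "y \<in> carrier G"
  shows "x \<otimes> y \<otimes> inv x \<otimes> inv y = \<one> \<longleftrightarrow> x \<otimes> y = y \<otimes> x"
  using assms by (metis inv_closed inv_solve_right' l_one m_closed one_closed)

lemma comm_mem_derived:
  "x \<in> carrier G \<Longrightarrow> y \<in> carrier G \<Longrightarrow> x \<otimes> y \<otimes> inv x \<otimes> inv y \<in> derived G (carrier G)"
  unfolding derived_def by (rule generate.incl) blast

lemma commutators_subset_carrier:
  "X \<subseteq> carrier G \<Longrightarrow> {x \<otimes> g \<otimes> inv x \<otimes> inv g | x g. x \<in> X \<and> g \<in> carrier G} \<subseteq> carrier G"
  by auto

lemma commutator_closure_normal: "X \<subseteq> carrier G \<Longrightarrow> commutator_closure G X \<lhd> G"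
  unfolding commutator_closure_def by (intro normal_closure_normal commutators_subset_carrier)

lemma comm_mem_commutator_closure:
  "x \<in> X \<Longrightarrow> g \<in> carrier G \<Longrightarrow> x \<otimes> g \<otimes> inv x \<otimes> inv g \<in> commutator_closure G X"
  unfolding commutator_closure_def by (rule subsetD[OF subset_normal_closure]) blast

lemma commutator_closure_least:
  assumes "N \<lhd> G" "\<And>x g. x \<in> X \<Longrightarrow> g \<in> carrier G \<Longrightarrow> x \<otimes> g \<otimes> inv x \<otimes> inv g \<in> N"
  shows "commutator_closure G X \<subseteq> N"
  unfolding commutator_closure_def using assms by (intro normal_closure_least) auto

lemma commutator_closure_subset:
  assumes "X \<subseteq> carrier G"
  shows "commutator_closure G X \<subseteq> normal_closure G X"
  using assms subset_normal_closure[of X] normal_closure_normal[OF assms]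
  by (intro commutator_closure_least comm_mem_normal) auto

lemma commutator_closure_subset_derived:
  assumes "X \<subseteq> carrier G"
  shows "commutator_closure G X \<subseteq> derived G (carrier G)"
  using assms by (intro commutator_closure_least derived_self_is_normal comm_mem_derived) auto

lemma commutator_closure_central_cong:
  assumes xy: "(x, y) \<in> rcong L"
    and central: "\<And>g l. g \<in> carrier G \<Longrightarrow> l \<in> L \<Longrightarrow> g \<otimes> l = l \<otimes> g"
  shows "commutator_closure G {x} = commutator_closure G {y}"
proof -
  define l where "l = inv x \<otimes> y"
  have c: "x \<in> carrier G" "y \<in> carrier G" "l \<in> carrier G" "l \<in> L"
    using xy by (auto simp: r_congruent_def l_def)
  have y: "y = x \<otimes> l" using c(1,2) by (simp add: l_def flip: m_assoc)
  have "y \<otimes> g \<otimes> inv y \<otimes> inv g = x \<otimes> g \<otimes> inv x \<otimes> inv g" if g: "g \<in> carrier G" for g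
  proof -
    have "y \<otimes> g \<otimes> inv y \<otimes> inv g = x \<otimes> (l \<otimes> g) \<otimes> inv l \<otimes> inv x \<otimes> inv g"
      unfolding y using c g by (simp add: m_assoc inv_mult_group)
    also have "l \<otimes> g = g \<otimes> l" using central[OF g c(4)] by simp
    also have "x \<otimes> (g \<otimes> l) \<otimes> inv l \<otimes> inv x \<otimes> inv g = x \<otimes> g \<otimes> (l \<otimes> inv l) \<otimes> inv x \<otimes> inv g"
      using c g by (simp only: m_assoc m_closed inv_closed)
    finally show ?thesis using c g by simp
  qed
  then show ?thesis
    unfolding commutator_closure_def by (intro arg_cong[of _ _ "normal_closure G"]) force
qed

lemma minimal_normal_exists:
  assumes fin: "finite (carrier G)" and N: "N \<lhd> G" "N \<noteq> {\<one>}"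
  obtains L where "minimal_normal G L" "L \<subseteq> N"
proof -
  let ?P = "\<lambda>L. L \<lhd> G \<and> L \<noteq> {\<one>} \<and> L \<subseteq> N"
  obtain L where L: "?P L" and least: "\<And>M. ?P M \<Longrightarrow> card L \<le> card M"
    using ex_has_least_nat[of ?P N card] N by auto
  have "minimal_normal G L"
    unfolding minimal_normal_def
  proof (intro conjI allI impI)
    fix M assume M: "M \<lhd> G \<and> M \<subseteq> L"
    have "finite L" using L fin normal_subset_carrier finite_subset by metis
    then show "M = {\<one>} \<or> M = L"
      using least[of M] M L by (metis card_seteq dual_order.trans)
  qed (use L in auto)
  then show ?thesis using that L by blast
qed

lemma minimal_normal_subset:
  assumes L: "minimal_normal G L" and N: "N \<lhd> G" and x: "x \<in> L" "x \<in> N" "x \<noteq> \<one>"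
  shows "L \<subseteq> N"
proof -
  have "L \<inter> N \<lhd> G" using L N by (simp add: minimal_normal_def normal_subgroup_intersect)
  then show ?thesis using L x unfolding minimal_normal_def by (metis Int_iff Int_lower1 Int_lower2 singletonD)
qed

text \<open>The commutator of \<open>x\<close> and \<open>l\<close> is a nontrivial element of \<open>L \<inter> N\<close>.\<close>

lemma minimal_normal_subset_of_noncommuting:
  assumes L: "minimal_normal G L" and N: "N \<lhd> G" and x: "x \<in> N"
    and l: "l \<in> L" "x \<otimes> l \<noteq> l \<otimes> x"
  shows "L \<subseteq> N"
proof (rule minimal_normal_subset[OF L N])
  have LN: "L \<lhd> G" using L by (simp add: minimal_normal_def)
  have c: "x \<in> carrier G" "l \<in> carrier G" using LN N x l normal_subset_carrier by auto
  show "x \<otimes> l \<otimes> inv x \<otimes> inv l \<in> L" using LN c l by (intro comm_mem_normal) auto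
  show "x \<otimes> l \<otimes> inv x \<otimes> inv l \<in> N" using N c x by (intro comm_mem_normal) auto
  show "x \<otimes> l \<otimes> inv x \<otimes> inv l \<noteq> \<one>" using comm_eq_one_iff c l by simp
qed

end

section \<open>Tuples congruent modulo a minimal normal subgroup\<close>

context group
begin

text \<open>The component \<open>xs ! i\<close> allows all components except the \<open>i\<close>-th to be moved to their target; after
  that \<open>ys ! j\<close> is among the components and allows the \<open>i\<close>-th one to be changed.\<close>

lemma AC_equivalent_if_two_act:
  assumes L: "minimal_normal G L"
    and cong: "list_all2 (\<lambda>x y. (x, y) \<in> rcong L) xs ys"
    and ij: "i < length xs" "j < length xs" "i \<noteq> j"
    and xi: "l \<in> L" "xs ! i \<otimes> l \<noteq> l \<otimes> xs ! i"
    and yj: "l' \<in> L" "ys ! j \<otimes> l' \<noteq> l' \<otimes> ys ! j"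
  shows "AC_equivalent G xs ys"
proof -
  have len: "length ys = length xs" using cong by (simp add: list_all2_lengthD)
  have nth: "(xs ! m, ys ! m) \<in> rcong L" if "m < length xs" for m
    using cong that by (auto simp: list_all2_conv_all_nth)
  have xsc: "set xs \<subseteq> carrier G" and ysc: "set ys \<subseteq> carrier G"
    using cong by (auto simp: list_all2_conv_all_nth r_congruent_def in_set_conv_nth)
  interpret L: normal L G using L by (simp add: minimal_normal_def)
  have xc: "xs ! i \<in> carrier G" using xsc ij by auto
  have "AC_equivalent G xs (ys[i := xs ! i])"
  proof (rule AC_change_other_components[where N = L and i = i])
    show "list_all2 (\<lambda>x y. (x, y) \<in> rcong L) xs (ys[i := xs ! i])"
      using nth len ij xc L.one_closed
      by (auto simp: list_all2_conv_all_nth nth_list_update r_congruent_def)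
    show "L \<subseteq> normal_closure G {xs ! i}"
      using xi xc subset_normal_closure[of "{xs ! i}"]
      by (intro minimal_normal_subset_of_noncommuting[OF L]) (auto intro: normal_closure_normal)
  qed (use ij len in auto)
  also have "AC_equivalent G (ys[i := xs ! i]) (ys[i := ys ! i])"
  proof (rule AC_change_component[OF ysc])
    have "ys ! j \<in> normal_closure G (other_components ys i)"
      using subset_normal_closure nth_in_other_components[of j ys i] ij len by auto
    then show "L \<subseteq> normal_closure G (other_components ys i)"
      using yj other_components_subset[of ys i] ysc
      by (intro minimal_normal_subset_of_noncommuting[OF L]) (auto intro: normal_closure_normal)
  qed (use nth ij len in auto)
  finally show ?thesis by simp
qed

text \<open>The centraliser of \<open>L\<close> is normal, so it cannot contain all components unless it is the whole
  group. With \<open>L = carrier G\<close> this yields a noncentral component.\<close>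

lemma component_acting_nontrivially:
  assumes xs: "xs \<in> normal_generating_tuples G k" and L: "L \<lhd> G"
    and nc: "g \<in> carrier G" "l \<in> L" "g \<otimes> l \<noteq> l \<otimes> g"
  obtains i l' where "i < length xs" "l' \<in> L" "xs ! i \<otimes> l' \<noteq> l' \<otimes> xs ! i"
proof -
  let ?C = "{g \<in> carrier G. \<forall>n\<in>L. g \<otimes> n = n \<otimes> g}"
  have "\<not> set xs \<subseteq> ?C"
  proof
    assume "set xs \<subseteq> ?C"
    then have "?C = carrier G"
      by (rule normal_generating_normal_eq[OF xs normal_centraliser_normal[OF L]])
    then have "g \<in> ?C" using nc(1) by (rule ssubst)
    then show False using nc by simp
  qed
  then obtain x where x: "x \<in> set xs" "x \<notin> ?C" by blast
  then obtain l' where "l' \<in> L" "x \<otimes> l' \<noteq> l' \<otimes> x"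
    using xs by (auto simp: normal_generating_tuples_def)
  then show thesis using that x(1) by (metis in_set_conv_nth)
qed

text \<open>Only one situation is not covered by \<open>AC_equivalent_if_two_act\<close>: in both tuples the \<open>i\<close>-th
  component moves \<open>L\<close>, and in \<open>ys\<close> all others centralise \<open>L\<close>. Then multiplying another component of
  each tuple by the \<open>i\<close>-th one produces a second component that moves \<open>L\<close>.\<close>

lemma AC_equivalent_mod_noncentral_minimal_normal:
  assumes L: "minimal_normal G L" and nc: "g \<in> carrier G" "l \<in> L" "g \<otimes> l \<noteq> l \<otimes> g"
    and k: "k \<ge> 2"
    and xs: "xs \<in> normal_generating_tuples G k" and ys: "ys \<in> normal_generating_tuples G k"
    and cong: "list_all2 (\<lambda>x y. (x, y) \<in> rcong L) xs ys"
  shows "AC_equivalent G xs ys"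
proof -
  interpret L: normal L G using L by (simp add: minimal_normal_def)
  have len: "length xs = k" "length ys = k" using xs ys by (auto simp: normal_generating_tuples_def)
  have xsc: "set xs \<subseteq> carrier G" and ysc: "set ys \<subseteq> carrier G"
    using xs ys by (auto simp: normal_generating_tuples_def)
  obtain i a where i: "i < k" "a \<in> L" "xs ! i \<otimes> a \<noteq> a \<otimes> xs ! i"
    using component_acting_nontrivially[OF xs L.normal_axioms nc] len by metis
  obtain j b where j: "j < k" "b \<in> L" "ys ! j \<otimes> b \<noteq> b \<otimes> ys ! j"
    using component_acting_nontrivially[OF ys L.normal_axioms nc] len by metis
  show ?thesis
  proof (cases "\<exists>m<k. m \<noteq> i \<and> (\<exists>c\<in>L. ys ! m \<otimes> c \<noteq> c \<otimes> ys ! m)")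
    case True
    then show ?thesis using AC_equivalent_if_two_act[OF L cong] i len by metis
  next
    case False
    then have ji: "j = i" using j by metis
    \<comment> \<open>any position other than \<open>i\<close>; it exists because \<open>k \<ge> 2\<close>\<close>
    define m :: nat where "m = (if i = 0 then 1 else 0)"
    have m: "m < k" "m \<noteq> i" using k by (auto simp: m_def)
    have ym: "ys ! m \<otimes> c = c \<otimes> ys ! m" if "c \<in> L" for c using False m that by blast
    have c: "xs ! i \<in> carrier G" "ys ! i \<in> carrier G" "ys ! m \<in> carrier G" "xs ! m \<in> carrier G"
      using xsc ysc i m len by auto
    define xs' where "xs' = xs[m := ys ! m \<otimes> xs ! i]"
    define ys' where "ys' = ys[m := ys ! m \<otimes> ys ! i]"
    have nth: "(xs ! n, ys ! n) \<in> rcong L" if "n < k" for n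
      using cong that len by (auto simp: list_all2_conv_all_nth)
    \<comment> \<open>First give the \<open>m\<close>-th component of \<open>xs\<close> the value \<open>ys ! m\<close>: this one centralises \<open>L\<close>, so that its
        product with \<open>xs ! i\<close> does not.\<close>
    have "AC_equivalent G xs (xs[m := ys ! m])"
    proof -
      have "L \<subseteq> normal_closure G (other_components xs m)"
        using minimal_normal_subset_of_noncommuting[OF L, of "normal_closure G (other_components xs m)" "xs ! i" a]
          i other_components_subset[of xs m] xsc normal_closure_normal[of "other_components xs m"]
          subset_normal_closure[of "other_components xs m"] nth_in_other_components[of i xs m] m len
        by auto
      then have "AC_equivalent G (xs[m := xs ! m]) (xs[m := ys ! m])"
        using nth m len by (intro AC_change_component[OF xsc]) auto
      then show ?thesis by simp
    qed
    also have "AC_equivalent G (xs[m := ys ! m]) xs'"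
      using AC_move.mult_right[of m "xs[m := ys ! m]" i G] m i len
      by (simp add: xs'_def AC_move_imp_equivalent)
    also have "AC_equivalent G xs' ys'"
    proof (rule AC_equivalent_if_two_act[OF L])
      have "inv (ys ! m \<otimes> xs ! i) \<otimes> (ys ! m \<otimes> ys ! i) = inv (xs ! i) \<otimes> (inv (ys ! m) \<otimes> ys ! m) \<otimes> ys ! i"
        using c by (simp only: m_assoc m_closed inv_closed inv_mult_group)
      then have "(ys ! m \<otimes> xs ! i, ys ! m \<otimes> ys ! i) \<in> rcong L"
        using nth[OF i(1)] c by (simp add: r_congruent_def)
      then show "list_all2 (\<lambda>x y. (x, y) \<in> rcong L) xs' ys'"
        using nth len m by (auto simp: xs'_def ys'_def list_all2_conv_all_nth nth_list_update)
      have "ys ! m \<otimes> xs ! i \<otimes> a \<noteq> a \<otimes> (ys ! m \<otimes> xs ! i)"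
      proof
        assume eq: "ys ! m \<otimes> xs ! i \<otimes> a = a \<otimes> (ys ! m \<otimes> xs ! i)"
        have ac: "a \<in> carrier G" using i by simp
        have "ys ! m \<otimes> (xs ! i \<otimes> a) = (a \<otimes> ys ! m) \<otimes> xs ! i" using eq c ac by (simp add: m_assoc)
        also have "\<dots> = ys ! m \<otimes> (a \<otimes> xs ! i)" using ym[OF i(2)] c ac by (simp flip: m_assoc)
        finally show False using i c ac by simp
      qed
      then show "xs' ! m \<otimes> a \<noteq> a \<otimes> xs' ! m" using m len by (simp add: xs'_def)
      show "ys' ! i \<otimes> b \<noteq> b \<otimes> ys' ! i" using j ji m by (simp add: ys'_def)
    qed (use i j m len in \<open>auto simp: xs'_def\<close>)
    also have "AC_equivalent G ys' ys"
    proof -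
      have "AC_equivalent G ys ys'"
        using AC_move.mult_right[of m ys i G] m i len by (simp add: ys'_def AC_move_imp_equivalent)
      then show ?thesis using AC_equivalent_sym ysc by blast
    qed
    finally show ?thesis .
  qed
qed

text \<open>Since \<open>L\<close> is central, \<open>[xs ! i, G] = [ys ! i, G]\<close>, so the new \<open>i\<close>-th component still has \<open>L\<close> in its
  normal closure and serves to change all the others. Hence only the \<open>i\<close>-th component has to be
  treated by hand.\<close>

lemma AC_equivalent_mod_central_subgroup:
  assumes L: "L \<lhd> G" and central: "\<And>g l. g \<in> carrier G \<Longrightarrow> l \<in> L \<Longrightarrow> g \<otimes> l = l \<otimes> g"
    and i: "i < length xs"
    and cong: "list_all2 (\<lambda>x y. (x, y) \<in> rcong L) xs ys"
    and LP: "L \<subseteq> commutator_closure G {xs ! i}"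
    and change: "AC_equivalent G xs (xs[i := ys ! i])"
  shows "AC_equivalent G xs ys"
proof -
  interpret L: normal L G by (rule L)
  have len: "length ys = length xs" using cong by (simp add: list_all2_lengthD)
  have nth: "(xs ! m, ys ! m) \<in> rcong L" if "m < length xs" for m
    using cong that by (auto simp: list_all2_conv_all_nth)
  have yc: "ys ! i \<in> carrier G" using nth[OF i] by (simp add: r_congruent_def)
  note change
  also have "AC_equivalent G (xs[i := ys ! i]) ys"
  proof (rule AC_change_other_components[where N = L and i = i])
    show "list_all2 (\<lambda>x y. (x, y) \<in> rcong L) (xs[i := ys ! i]) ys"
    proof (rule list_all2_all_nthI)
      fix m assume "m < length (xs[i := ys ! i])"
      then show "(xs[i := ys ! i] ! m, ys ! m) \<in> rcong L"
        using nth[of m] yc by (cases "m = i") (auto simp: r_congruent_def)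
    qed (simp add: len)
    show "L \<subseteq> normal_closure G {xs[i := ys ! i] ! i}"
      using LP commutator_closure_central_cong[OF nth[OF i] central] i yc
        commutator_closure_subset[of "{ys ! i}"] by auto
  qed (use i in auto)
  finally show ?thesis .
qed

text \<open>Suppose that \<open>[x, G]\<close> centralised every conjugate of \<open>x = xs ! i\<close>. As each conjugate of \<open>x\<close> differs
  from \<open>x\<close> by an element of \<open>[x, G]\<close>, the conjugates of \<open>x\<close> would commute with each other. The other
  components commute with them by hypothesis, hence all components would lie in the normal subgroup centralising the conjugates of \<open>x\<close>, and \<open>x\<close> would be
  central.\<close>

lemma noncommuting_with_conjugate:
  assumes xs: "xs \<in> normal_generating_tuples G k" and i: "i < k"
    and nc: "g \<in> carrier G" "xs ! i \<otimes> g \<noteq> g \<otimes> xs ! i"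
    and triv: "\<And>j w. j < k \<Longrightarrow> j \<noteq> i \<Longrightarrow> w \<in> carrier G \<Longrightarrow>
      xs ! j \<otimes> (inv w \<otimes> xs ! i \<otimes> w) = (inv w \<otimes> xs ! i \<otimes> w) \<otimes> xs ! j"
  obtains (witness) y w where "y \<in> commutator_closure G {xs ! i}" "w \<in> carrier G"
    "y \<otimes> (inv w \<otimes> xs ! i \<otimes> w) \<noteq> (inv w \<otimes> xs ! i \<otimes> w) \<otimes> y"
proof (rule ccontr)
  assume neg: "\<not> thesis"
  have comm: "y \<otimes> (inv w \<otimes> xs ! i \<otimes> w) = (inv w \<otimes> xs ! i \<otimes> w) \<otimes> y"
    if "y \<in> commutator_closure G {xs ! i}" "w \<in> carrier G" for y w
    using witness[OF that] neg by blast
  let ?x = "xs ! i"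
  let ?S = "{inv w \<otimes> ?x \<otimes> w | w. w \<in> carrier G}"
  let ?C = "{g \<in> carrier G. \<forall>s\<in>?S. g \<otimes> s = s \<otimes> g}"
  have len: "length xs = k" and xsc: "set xs \<subseteq> carrier G"
    using xs by (auto simp: normal_generating_tuples_def)
  have xc: "?x \<in> carrier G" using xsc i len by auto
  have "?C \<lhd> G"
  proof (rule centraliser_normal)
    fix g s assume g: "g \<in> carrier G" and "s \<in> ?S"
    then obtain w where w: "w \<in> carrier G" "s = inv w \<otimes> ?x \<otimes> w" by blast
    have "inv g \<otimes> s \<otimes> g = inv (w \<otimes> g) \<otimes> ?x \<otimes> (w \<otimes> g)"
      unfolding w using w g xc by (simp add: m_assoc inv_mult_group)
    then show "inv g \<otimes> s \<otimes> g \<in> ?S" using w g by blast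
  qed (use xc in auto)
  moreover have "set xs \<subseteq> ?C"
  proof
    fix z assume "z \<in> set xs"
    then obtain j where j: "j < k" "z = xs ! j" using len by (auto simp: in_set_conv_nth)
    have "z \<otimes> (inv w \<otimes> ?x \<otimes> w) = (inv w \<otimes> ?x \<otimes> w) \<otimes> z" if w: "w \<in> carrier G" for w
    proof (cases "j = i")
      case True
      define d where "d = ?x \<otimes> inv w \<otimes> inv ?x \<otimes> inv (inv w)"
      have d: "d \<in> commutator_closure G {?x}" unfolding d_def using w by (intro comm_mem_commutator_closure) auto
      have dc: "d \<in> carrier G" using xc w by (simp add: d_def)
      have "d \<otimes> ?x = ?x \<otimes> d" using comm[OF d one_closed] xc by simp
      moreover have "inv w \<otimes> ?x \<otimes> w = inv d \<otimes> ?x"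
        using xc w by (simp add: d_def inv_mult_group m_assoc)
      moreover have "?x \<otimes> inv d = inv d \<otimes> ?x"
        using \<open>d \<otimes> ?x = ?x \<otimes> d\<close> dc xc by (metis inv_closed inv_solve_left inv_solve_right m_assoc m_closed)
      ultimately show ?thesis using True j xc dc by (simp flip: m_assoc)
    next
      case False
      then show ?thesis using triv j w by blast
    qed
    then show "z \<in> ?C" using j xsc len by auto
  qed
  ultimately have "?C = carrier G" by (rule normal_generating_normal_eq[OF xs])
  then have "g \<in> ?C" using nc(1) by (rule ssubst)
  moreover have "?x \<in> ?S" using xc by (auto intro!: exI[of _ \<one>])
  ultimately have "g \<otimes> ?x = ?x \<otimes> g" by blast
  then show False using nc by simp
qed

text \<open>The choice of \<open>L\<close> depends on the tuple. For a noncentral component \<open>x = xs ! i\<close>, with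
  \<open>?P = [x, G]\<close> and \<open>?R\<close> the same for the other components, it is taken inside \<open>?P \<inter> ?R\<close> if that is
  nontrivial. Otherwise a component \<open>u = xs ! m\<close> is temporarily replaced by \<open>?u = u y\<close> with \<open>y \<in> ?P\<close>, in
  such a way that \<open>[?u, G]\<close> meets \<open>?P\<close> nontrivially, and \<open>L\<close> is taken there.\<close>

lemma AC_equivalent_mod_some_central_subgroup:
  assumes fin: "finite (carrier G)"
    and central: "\<And>L g l. \<lbrakk>minimal_normal G L; L \<subseteq> derived G (carrier G); g \<in> carrier G; l \<in> L\<rbrakk>
      \<Longrightarrow> g \<otimes> l = l \<otimes> g"
    and k: "k \<ge> 2" and xs: "xs \<in> normal_generating_tuples G k"
    and nonabelian: "a \<in> carrier G" "b \<in> carrier G" "a \<otimes> b \<noteq> b \<otimes> a"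
  obtains (found) L where "minimal_normal G L" "L \<subseteq> derived G (carrier G)"
    "\<And>ys. list_all2 (\<lambda>x y. (x, y) \<in> rcong L) xs ys \<Longrightarrow> AC_equivalent G xs ys"
proof -
  have len: "length xs = k" and xsc: "set xs \<subseteq> carrier G"
    using xs by (auto simp: normal_generating_tuples_def)
  obtain i g where i: "i < k" and g: "g \<in> carrier G" "xs ! i \<otimes> g \<noteq> g \<otimes> xs ! i"
    using component_acting_nontrivially[OF xs normal_self nonabelian] len by metis
  let ?x = "xs ! i" and ?X = "other_components xs i"
  let ?P = "commutator_closure G {?x}" and ?R = "commutator_closure G ?X"
  have xc: "?x \<in> carrier G" and Xc: "?X \<subseteq> carrier G"
    using xsc i len other_components_subset[of xs i] by auto
  have P: "?P \<lhd> G" and R: "?R \<lhd> G"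
    using xc Xc by (auto intro: commutator_closure_normal)
  have P': "?P \<subseteq> derived G (carrier G)" using xc by (intro commutator_closure_subset_derived) auto
  have Pcong: "commutator_closure G {?x} = commutator_closure G {ys ! i}"
    if "minimal_normal G L" "L \<subseteq> ?P" "list_all2 (\<lambda>x y. (x, y) \<in> rcong L) xs ys" for L ys
    using that(3) i len
    by (intro commutator_closure_central_cong[of _ _ L] central[OF that(1) subset_trans[OF that(2) P']])
       (auto simp: list_all2_conv_all_nth)
  have suffices: thesis
    if L: "minimal_normal G L" "L \<subseteq> ?P"
      and change: "\<And>ys. list_all2 (\<lambda>x y. (x, y) \<in> rcong L) xs ys \<Longrightarrow> AC_equivalent G xs (xs[i := ys ! i])"
    for L
  proof (rule found[OF L(1)])
    show "L \<subseteq> derived G (carrier G)" using L P' by simp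
    fix ys assume cong: "list_all2 (\<lambda>x y. (x, y) \<in> rcong L) xs ys"
    have LN: "L \<lhd> G" using L by (simp add: minimal_normal_def)
    show "AC_equivalent G xs ys"
      by (rule AC_equivalent_mod_central_subgroup[OF LN central[OF L(1) subset_trans[OF L(2) P']]
            _ cong L(2) change[OF cong]]) (use i len in simp_all)
  qed
  show thesis
  proof (cases "?P \<inter> ?R = {\<one>}")
    case False
    then obtain L where L: "minimal_normal G L" "L \<subseteq> ?P \<inter> ?R"
      using minimal_normal_exists[OF fin normal_subgroup_intersect[OF P R]] by blast
    have "L \<subseteq> normal_closure G ?X" using L commutator_closure_subset[OF Xc] by blast
    then have "AC_equivalent G (xs[i := xs ! i]) (xs[i := ys ! i])"
      if "list_all2 (\<lambda>x y. (x, y) \<in> rcong L) xs ys" for ys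
      using that i len by (intro AC_change_component[OF xsc]) (auto simp: list_all2_conv_all_nth)
    then show thesis using suffices L by simp
  next
    case True
    have conj_eq: "inv w \<otimes> ?x \<otimes> w \<in> carrier G" if "w \<in> carrier G" for w using that xc by simp
    \<comment> \<open>The commutator of \<open>z\<close> with \<open>x\<^sup>w\<close> is the inverse of a conjugate of the commutator of \<open>x\<close> with
        \<open>w z w\<^sup>-\<^sup>1\<close>.\<close>
    have commP: "z \<otimes> (inv w \<otimes> ?x \<otimes> w) \<otimes> inv z \<otimes> inv (inv w \<otimes> ?x \<otimes> w) \<in> ?P"
      if z: "z \<in> carrier G" and w: "w \<in> carrier G" for z w
    proof -
      let ?v = "w \<otimes> z \<otimes> inv w"
      have "inv w \<otimes> (?x \<otimes> ?v \<otimes> inv ?x \<otimes> inv ?v) \<otimes> w \<in> ?P"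
        using z w by (intro normal_conj(1)[OF P] comm_mem_commutator_closure) auto
      then have "inv (inv w \<otimes> (?x \<otimes> ?v \<otimes> inv ?x \<otimes> inv ?v) \<otimes> w) \<in> ?P"
        by (rule subgroup.m_inv_closed[OF normal_imp_subgroup[OF P]])
      moreover have "inv (inv w \<otimes> (?x \<otimes> ?v \<otimes> inv ?x \<otimes> inv ?v) \<otimes> w)
          = z \<otimes> (inv w \<otimes> ?x \<otimes> w) \<otimes> inv z \<otimes> inv (inv w \<otimes> ?x \<otimes> w)"
        using z w xc by (simp add: m_assoc inv_mult_group mult_inv_cancel_left)
      ultimately show ?thesis by simp
    qed
    \<comment> \<open>both \<open>?P\<close> and \<open>?R\<close> contain the commutators of \<open>xs ! j\<close> with the conjugates of \<open>x\<close>\<close>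
    have triv: "xs ! j \<otimes> (inv w \<otimes> ?x \<otimes> w) = (inv w \<otimes> ?x \<otimes> w) \<otimes> xs ! j"
      if "j < k" "j \<noteq> i" "w \<in> carrier G" for j w
    proof -
      have j: "xs ! j \<in> ?X" "xs ! j \<in> carrier G"
        using that nth_in_other_components[of j xs i] Xc len by auto
      have "xs ! j \<otimes> (inv w \<otimes> ?x \<otimes> w) \<otimes> inv (xs ! j) \<otimes> inv (inv w \<otimes> ?x \<otimes> w) \<in> ?P \<inter> ?R"
        using commP[OF j(2) that(3)] comm_mem_commutator_closure[OF j(1) conj_eq] that by simp
      then show ?thesis using True comm_eq_one_iff[OF j(2) conj_eq] that by simp
    qed
    obtain y w where y: "y \<in> ?P" and w: "w \<in> carrier G"
      and ne: "y \<otimes> (inv w \<otimes> ?x \<otimes> w) \<noteq> (inv w \<otimes> ?x \<otimes> w) \<otimes> y"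
      using noncommuting_with_conjugate[OF xs i g triv] by blast
    define z where "z = inv w \<otimes> ?x \<otimes> w"
    have zc: "z \<in> carrier G" using w xc by (simp add: z_def)
    have yc: "y \<in> carrier G" using y normal_subset_carrier[OF P] by auto
    define m :: nat where "m = (if i = 0 then 1 else 0)"
    have m: "m < k" "m \<noteq> i" using k by (auto simp: m_def)
    have mc: "xs ! m \<in> carrier G" using xsc m len by auto
    let ?u = "xs ! m \<otimes> y"
    define c where "c = ?u \<otimes> z \<otimes> inv ?u \<otimes> inv z"
    have cP: "c \<in> ?P" unfolding c_def z_def using mc yc w by (intro commP) auto
    have cu: "c \<in> commutator_closure G {?u}" unfolding c_def using zc by (intro comm_mem_commutator_closure) auto
    have cc: "c \<in> carrier G" using cP normal_subset_carrier[OF P] by auto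
    have "c \<noteq> \<one>"
    proof
      assume "c = \<one>"
      then have eq: "?u \<otimes> z = z \<otimes> ?u" unfolding c_def using comm_eq_one_iff mc yc zc by simp
      have "xs ! m \<otimes> (y \<otimes> z) = z \<otimes> xs ! m \<otimes> y" using eq mc yc zc by (simp add: m_assoc)
      also have "z \<otimes> xs ! m = xs ! m \<otimes> z" using triv[OF m w] by (simp add: z_def)
      also have "xs ! m \<otimes> z \<otimes> y = xs ! m \<otimes> (z \<otimes> y)" using mc yc zc by (simp add: m_assoc)
      finally show False using ne mc yc zc by (simp add: z_def)
    qed
    then have "normal_closure G {c} \<noteq> {\<one>}" using subset_normal_closure[of "{c}"] by auto
    then obtain L where L: "minimal_normal G L" "L \<subseteq> normal_closure G {c}"
      using minimal_normal_exists[OF fin normal_closure_normal] cc by (metis empty_subsetI insert_subset)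
    have LP: "L \<subseteq> ?P" using L normal_closure_least[OF P] cP by blast
    have "L \<subseteq> commutator_closure G {?u}"
      using L normal_closure_least[OF commutator_closure_normal, of "{?u}" "{c}"] cu mc yc by auto
    then have Lu: "L \<subseteq> normal_closure G {?u}"
      using commutator_closure_subset[of "{?u}"] mc yc by auto
    show thesis
    proof (rule suffices[OF L(1) LP])
      fix ys assume cong: "list_all2 (\<lambda>x y. (x, y) \<in> rcong L) xs ys"
      let ?xs' = "xs[m := ?u]"
      have yic: "ys ! i \<in> carrier G" and xyi: "(?x, ys ! i) \<in> rcong L"
        using cong i len by (auto simp: list_all2_conv_all_nth r_congruent_def)
      have xs'c: "set ?xs' \<subseteq> carrier G" using xsc mc yc by (intro set_update_subsetI) auto
      have xsic: "set (xs[i := ys ! i]) \<subseteq> carrier G" using xsc yic by (intro set_update_subsetI) auto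
      have mult: "AC_equivalent G zs (zs[m := zs ! m \<otimes> y])"
        if zs: "set zs \<subseteq> carrier G" "length zs = k" "commutator_closure G {zs ! i} = ?P" for zs
      proof -
        have "zs ! i \<in> other_components zs m" using zs i m by (intro nth_in_other_components) auto
        moreover have "zs ! i \<in> carrier G" "zs ! m \<in> carrier G" using zs i m by auto
        ultimately have "y \<in> normal_closure G (other_components zs m)"
          using y zs commutator_closure_subset[of "{zs ! i}"]
            normal_closure_mono[of "{zs ! i}" "other_components zs m"] by auto
        then have "AC_equivalent G (zs[m := zs ! m]) (zs[m := zs ! m \<otimes> y])"
          using zs m \<open>zs ! m \<in> carrier G\<close> by (intro AC_mult_normal_closure) auto
        then show ?thesis by simp
      qed
      \<comment> \<open>Replace \<open>u\<close> by \<open>u y\<close>, change \<open>x\<close> using \<open>L \<le> [u y, G]\<close>, and restore \<open>u\<close>. The last step is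
          possible because multiplying \<open>x\<close> by an element of the central subgroup \<open>L\<close> leaves \<open>?P\<close> as it is.\<close>
      have "AC_equivalent G xs ?xs'" using mult[of xs] xsc len by simp
      also have "AC_equivalent G ?xs' (?xs'[i := ys ! i])"
      proof -
        have "?u \<in> other_components ?xs' i" using nth_in_other_components[of m ?xs' i] m len by simp
        then have "L \<subseteq> normal_closure G (other_components ?xs' i)"
          using Lu normal_closure_mono[of "{?u}" "other_components ?xs' i"] by auto
        then have "AC_equivalent G (?xs'[i := ?x]) (?xs'[i := ys ! i])"
          using xyi i len by (intro AC_change_component[OF xs'c]) auto
        moreover have "?xs'[i := ?x] = ?xs'" using m by (metis list_update_id nth_list_update_neq)
        ultimately show ?thesis by simp
      qed
      also have "AC_equivalent G (?xs'[i := ys ! i]) (xs[i := ys ! i])"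
      proof -
        have "AC_equivalent G (xs[i := ys ! i]) (xs[i := ys ! i, m := xs[i := ys ! i] ! m \<otimes> y])"
          using Pcong[OF L(1) LP cong] xsic len i by (intro mult) auto
        also have "xs[i := ys ! i, m := xs[i := ys ! i] ! m \<otimes> y] = ?xs'[i := ys ! i]"
          using m by (simp add: list_update_swap)
        finally show ?thesis using xsic by (rule AC_equivalent_sym)
      qed
      finally show "AC_equivalent G xs (xs[i := ys ! i])" .
    qed
  qed
qed

end

section \<open>Surjective homomorphisms\<close>

context group_hom
begin

lemma AC_move_map:
  assumes "AC_move G xs ys" "set xs \<subseteq> carrier G"
  shows "AC_move H (map h xs) (map h ys)"
  using assms
proof cases
  case (mult_right i j)
  then show ?thesis
    using AC_move.mult_right[of i "map h xs" j H] assms(2) by (auto simp: map_update subset_iff)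
next
  case (mult_right_inv i j)
  then show ?thesis
    using AC_move.mult_right_inv[of i "map h xs" j H] assms(2) by (auto simp: map_update subset_iff)
next
  case (mult_left i j)
  then show ?thesis
    using AC_move.mult_left[of i "map h xs" j H] assms(2) by (auto simp: map_update subset_iff)
next
  case (mult_left_inv i j)
  then show ?thesis
    using AC_move.mult_left_inv[of i "map h xs" j H] assms(2) by (auto simp: map_update subset_iff)
next
  case (invert i)
  then show ?thesis
    using AC_move.invert[of i "map h xs" H] assms(2) by (auto simp: map_update subset_iff)
next
  case (conjugate i w)
  then show ?thesis
    using AC_move.conjugate[of i "map h xs" "h w" H] assms(2) by (auto simp: map_update subset_iff)
qed

lemma AC_equivalent_map:
  assumes "AC_equivalent G xs ys" and xs: "set xs \<subseteq> carrier G"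
  shows "AC_equivalent H (map h xs) (map h ys)"
  using assms(1) unfolding AC_equivalent_def
proof (induction rule: rtranclp_induct)
  case (step ys zs)
  have "set ys \<subseteq> carrier G"
    using G.AC_equivalent_closed[OF _ xs] step(1) by (simp add: AC_equivalent_def)
  then have "AC_move H (map h ys) (map h zs)" using AC_move_map step(2) by blast
  then show ?case using step(3) by (rule rtranclp.rtrancl_into_rtrancl[rotated])
qed simp

lemma image_normal_closure_eq_carrier:
  assumes surj: "h ` carrier G = carrier H" and Y: "Y \<subseteq> carrier G"
    and gen: "normal_closure G Y = carrier G"
  shows "normal_closure H (h ` Y) = carrier H"
proof -
  have hY: "h ` Y \<subseteq> carrier H" using Y by auto
  let ?M = "normal_closure H (h ` Y)"
  interpret M: normal ?M H by (rule H.normal_closure_normal[OF hY])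
  have "{x \<in> carrier G. h x \<in> ?M} \<lhd> G"
    by (rule G.normal_invI) (auto intro!: G.subgroupI exI[of _ "\<one>"] M.inv_op_closed2)
  moreover have "Y \<subseteq> {x \<in> carrier G. h x \<in> ?M}"
    using Y H.subset_normal_closure[of "h ` Y"] by auto
  ultimately have "normal_closure G Y \<subseteq> {x \<in> carrier G. h x \<in> ?M}"
    by (rule G.normal_closure_least)
  then have "h ` carrier G \<subseteq> ?M" using gen by blast
  then show ?thesis using surj M.subset by auto
qed

lemma map_normal_generating:
  assumes surj: "h ` carrier G = carrier H" and xs: "xs \<in> normal_generating_tuples G k"
  shows "map h xs \<in> normal_generating_tuples H k"
  using image_normal_closure_eq_carrier[OF surj, of "set xs"] xs
  by (auto simp: normal_generating_tuples_def)

lemma congruent_mod_kernel: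
  assumes xs: "set xs \<subseteq> carrier G" "set ys \<subseteq> carrier G" and eq: "map h xs = map h ys"
  shows "list_all2 (\<lambda>x y. (x, y) \<in> rcong\<^bsub>G\<^esub> (kernel G H h)) xs ys"
proof (rule list_all2_all_nthI)
  show len: "length xs = length ys" using eq by (rule map_eq_imp_length_eq)
  fix i assume i: "i < length xs"
  have c: "xs ! i \<in> carrier G" "ys ! i \<in> carrier G" using xs i len by auto
  have "h (xs ! i) = h (ys ! i)" using eq i len by (metis nth_map)
  then show "(xs ! i, ys ! i) \<in> rcong\<^bsub>G\<^esub> (kernel G H h)"
    using c by (simp add: r_congruent_def kernel_def)
qed

lemma map_eq_if_congruent_mod_kernel:
  assumes "list_all2 (\<lambda>x y. (x, y) \<in> rcong\<^bsub>G\<^esub> (kernel G H h)) xs ys"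
  shows "map h xs = map h ys"
proof -
  have "h x = h y" if xy: "(x, y) \<in> rcong\<^bsub>G\<^esub> (kernel G H h)" for x y
  proof -
    have c: "x \<in> carrier G" "y \<in> carrier G" "inv\<^bsub>H\<^esub> (h x) \<otimes>\<^bsub>H\<^esub> h y = \<one>\<^bsub>H\<^esub>"
      using xy by (auto simp: r_congruent_def kernel_def)
    then have "h x \<otimes>\<^bsub>H\<^esub> (inv\<^bsub>H\<^esub> (h x) \<otimes>\<^bsub>H\<^esub> h y) = h x" by simp
    then show ?thesis using H.mult_inv_cancel_left(1)[of "h x" "h y"] c by simp
  qed
  then have "list_all2 (\<lambda>x y. h x = h y) xs ys" by (rule list.rel_mono_strong[OF assms])
  then show ?thesis by (simp add: list_all2_conv_all_nth list_eq_iff_nth_eq)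
qed

lemma congruent_map:
  assumes "list_all2 (\<lambda>x y. (x, y) \<in> rcong\<^bsub>G\<^esub> N) xs ys"
  shows "list_all2 (\<lambda>x y. (x, y) \<in> rcong\<^bsub>H\<^esub> (h ` N)) (map h xs) (map h ys)"
  unfolding list.rel_map
proof (rule list.rel_mono_strong[OF assms])
  fix x y assume "(x, y) \<in> rcong\<^bsub>G\<^esub> N"
  then have c: "x \<in> carrier G" "y \<in> carrier G" "inv x \<otimes> y \<in> N" by (auto simp: r_congruent_def)
  then have "h (inv x \<otimes> y) \<in> h ` N" by blast
  then show "(h x, h y) \<in> rcong\<^bsub>H\<^esub> (h ` N)" using c by (simp add: r_congruent_def)
qed

context
  assumes surj: "h ` carrier G = carrier H"
begin

lemma AC_move_lift:
  assumes move: "AC_move H (map h xs) zs" and xs: "set xs \<subseteq> carrier G"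
  obtains ys where "AC_move G xs ys" "map h ys = zs"
  using move
proof cases
  case (mult_right i j)
  then show thesis
    using that[OF AC_move.mult_right[of i xs j G]] xs by (auto simp: map_update subset_iff)
next
  case (mult_right_inv i j)
  then show thesis
    using that[OF AC_move.mult_right_inv[of i xs j G]] xs by (auto simp: map_update subset_iff)
next
  case (mult_left i j)
  then show thesis
    using that[OF AC_move.mult_left[of i xs j G]] xs by (auto simp: map_update subset_iff)
next
  case (mult_left_inv i j)
  then show thesis
    using that[OF AC_move.mult_left_inv[of i xs j G]] xs by (auto simp: map_update subset_iff)
next
  case (invert i)
  then show thesis
    using that[OF AC_move.invert[of i xs G]] xs by (auto simp: map_update subset_iff)
next
  case (conjugate i w)
  then obtain v where "v \<in> carrier G" "w = h v" using surj by blast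
  then show thesis
    using that[OF AC_move.conjugate[of i xs v G]] conjugate xs by (auto simp: map_update subset_iff)
qed

lemma AC_equivalent_lift:
  assumes "AC_equivalent H (map h xs) zs" and xs: "set xs \<subseteq> carrier G"
  obtains ys where "AC_equivalent G xs ys" "map h ys = zs"
proof -
  from assms(1) have "\<exists>ys. AC_equivalent G xs ys \<and> map h ys = zs"
    unfolding AC_equivalent_def
  proof (induction rule: rtranclp_induct)
    case (step us vs)
    then obtain ys where ys: "(AC_move G)\<^sup>*\<^sup>* xs ys" "map h ys = us" by blast
    have "set ys \<subseteq> carrier G"
      using G.AC_equivalent_closed[OF _ xs] ys(1) by (simp add: AC_equivalent_def)
    then obtain ws where "AC_move G ys ws" "map h ws = vs"
      using AC_move_lift step(2) ys(2) by metis
    then show ?case using rtranclp.rtrancl_into_rtrancl[OF ys(1)] by blast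
  qed auto
  then show thesis using that by blast
qed

lemma AC_equivalent_lift_mod_kernel:
  assumes eqv: "AC_equivalent H (map h xs) (map h ys)"
    and xs: "set xs \<subseteq> carrier G" and ys: "set ys \<subseteq> carrier G"
  obtains zs where "AC_equivalent G xs zs"
    "list_all2 (\<lambda>x y. (x, y) \<in> rcong\<^bsub>G\<^esub> (kernel G H h)) ys zs"
proof -
  obtain zs where zs: "AC_equivalent G xs zs" "map h zs = map h ys"
    using AC_equivalent_lift[OF eqv xs] .
  then show thesis
    using that congruent_mod_kernel[OF ys, of zs] G.AC_equivalent_closed[OF zs(1) xs] by simp
qed

lemma derived_image: "h ` derived G (carrier G) = derived H (carrier H)"
  using derived_img[of "carrier G"] surj by simp

lemma normal_eq_carrier_if_image:
  assumes N: "N \<lhd> G" and ker: "kernel G H h \<subseteq> N" and img: "h ` N = carrier H"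
  shows "N = carrier G"
proof
  interpret N: normal N G by (rule N)
  show "carrier G \<subseteq> N"
  proof
    fix x assume x: "x \<in> carrier G"
    then obtain n where n: "n \<in> N" "h n = h x" using img by (metis hom_closed imageE)
    then have "inv n \<otimes> x \<in> kernel G H h" using x by (simp add: kernel_def)
    then have "inv n \<otimes> x \<in> N" using ker by blast
    then have "n \<otimes> (inv n \<otimes> x) \<in> N" by (rule N.m_closed[OF n(1)])
    then show "x \<in> N" using G.mult_inv_cancel_left(1)[of n x] x n(1) by simp
  qed
qed (rule G.normal_subset_carrier[OF N])

lemma normal_eq_carrier_if_map_generates:
  assumes xs: "map h xs \<in> normal_generating_tuples H k"
    and N: "N \<lhd> G" and ker: "kernel G H h \<subseteq> N" and sub: "set xs \<subseteq> N"
  shows "N = carrier G"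
proof (rule normal_eq_carrier_if_image[OF N ker])
  have "h ` N \<lhd> H"
    using normal.surj_hom_normal_subgroup[OF N group_hom_axioms surj] .
  then show "h ` N = carrier H" using sub by (intro H.normal_generating_normal_eq[OF xs]) auto
qed

lemma congruent_lift:
  assumes N: "N \<lhd> G" and xs: "set xs \<subseteq> carrier G"
    and cong: "list_all2 (\<lambda>x y. (x, y) \<in> rcong\<^bsub>H\<^esub> (h ` N)) (map h xs) ws"
  obtains ys where "map h ys = ws" "list_all2 (\<lambda>x y. (x, y) \<in> rcong\<^bsub>G\<^esub> N) xs ys"
proof -
  have len: "length ws = length xs" using cong by (simp add: list_all2_conv_all_nth)
  have "\<exists>y. h y = ws ! i \<and> (xs ! i, y) \<in> rcong\<^bsub>G\<^esub> N" if i: "i < length xs" for i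
  proof -
    have x: "xs ! i \<in> carrier G" using xs i by auto
    have "(h (xs ! i), ws ! i) \<in> rcong\<^bsub>H\<^esub> (h ` N)"
      using cong i by (auto simp: list_all2_conv_all_nth)
    then obtain n where n: "n \<in> N" and w: "ws ! i \<in> carrier H"
      and eq: "inv\<^bsub>H\<^esub> (h (xs ! i)) \<otimes>\<^bsub>H\<^esub> ws ! i = h n"
      by (auto simp: r_congruent_def)
    have nc: "n \<in> carrier G" using n G.normal_subset_carrier[OF N] by auto
    have "h (xs ! i \<otimes> n) = h (xs ! i) \<otimes>\<^bsub>H\<^esub> (inv\<^bsub>H\<^esub> (h (xs ! i)) \<otimes>\<^bsub>H\<^esub> ws ! i)"
      using x nc eq by simp
    also have "\<dots> = ws ! i" using x w by (intro H.mult_inv_cancel_left(1)) auto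
    finally have "h (xs ! i \<otimes> n) = ws ! i" .
    moreover have "(xs ! i, xs ! i \<otimes> n) \<in> rcong\<^bsub>G\<^esub> N"
      using x n nc by (simp add: r_congruent_def G.mult_inv_cancel_left)
    ultimately show ?thesis by blast
  qed
  then obtain f where f: "h (f i) = ws ! i" "(xs ! i, f i) \<in> rcong\<^bsub>G\<^esub> N" if "i < length xs" for i
    by metis
  show thesis
  proof
    show "map h (map f [0..<length xs]) = ws" using f(1) len by (intro nth_equalityI) auto
    show "list_all2 (\<lambda>x y. (x, y) \<in> rcong\<^bsub>G\<^esub> N) xs (map f [0..<length xs])"
      using f(2) by (intro list_all2_all_nthI) auto
  qed
qed

end

end

lemma group_monoid_extend:
  assumes "group M"
  shows "group (monoid.extend M e)"
proof -
  interpret group M by (rule assms)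
  show ?thesis
    by (rule groupI) (auto simp: monoid.extend_def m_assoc intro: l_inv_ex)
qed

text \<open>A copy of \<open>G/N\<close> that lives on coset representatives, hence in the same type as \<open>G\<close>. This is what
  allows an induction that passes from a group to its quotients, since the type is fixed throughout
  an induction.\<close>

lemma (in group) quotient_on_representatives:
  assumes N: "N \<lhd> G"
  obtains Q :: "('a, 'b) monoid_scheme" and h
  where "group_hom G Q h" "h ` carrier G = carrier Q" "kernel G Q h = N"
proof -
  interpret N: normal N G by (rule N)
  define f where "f x = (SOME y. y \<in> N #> x)" for x
  have f: "f x \<in> N #> x" if "x \<in> carrier G" for x
    unfolding f_def using rcos_self[OF that N.subgroup_axioms] by (rule someI)
  have wgm: "weak_group_morphism f N G"
  proof (rule weak_group_morphismsI[OF N])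
    fix a b assume ab: "a \<in> carrier G" "b \<in> carrier G"
    have rep: "N #> x = N #> f x" if "x \<in> carrier G" for x
      using repr_independence[OF f[OF that] that N.subgroup_axioms] .
    have "f a = f b \<longleftrightarrow> N #> a = N #> b"
    proof
      assume eq: "f a = f b"
      have "N #> a = N #> f a" using ab(1) by (rule rep)
      also have "\<dots> = N #> b" unfolding eq using ab(2) by (rule rep[symmetric])
      finally show "N #> a = N #> b" .
    qed (simp add: f_def)
    also have "\<dots> \<longleftrightarrow> N #> (a \<otimes> inv b) = N"
      using coset_mult_inv1[OF _ ab N.subset] coset_mult_inv2[OF _ ab N.subset] by (rule iffI[rotated])
    also have "\<dots> \<longleftrightarrow> a \<otimes> inv b \<in> N"
      using coset_join1[OF _ _ N.subgroup_axioms] coset_join2[OF _ N.subgroup_axioms] ab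
      by (intro iffI) simp_all
    finally show "f a = f b \<longleftrightarrow> a \<otimes> inv b \<in> N" .
  qed
  \<comment> \<open>the fields beyond the group structure are copied from \<open>G\<close>, so that \<open>Q\<close> has the record type of \<open>G\<close>\<close>
  define Q where "Q = monoid.extend (image_group f G) (monoid.more G)"
  have Q: "carrier Q = f ` carrier G" "monoid.mult Q = monoid.mult (image_group f G)" "one Q = one (image_group f G)"
    by (simp_all add: Q_def monoid.extend_def image_group_carrier)
  show thesis
  proof
    have "group Q"
      unfolding Q_def by (rule group_monoid_extend[OF image_group_is_group[OF wgm]])
    moreover have "f \<in> hom G Q"
      using weak_group_morphism_is_hom[OF wgm] Q by (simp add: hom_def image_group_carrier)
    ultimately show "group_hom G Q f"
      by (intro group_hom.intro group_hom_axioms.intro is_group)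
    show "kernel G Q f = N"
      using weak_group_morphism_ker[OF wgm] Q by (simp add: kernel_def)
  qed (use Q in simp)
qed

lemma (in group_hom) card_image_less:
  assumes "finite (carrier G)" "h ` carrier G = carrier H" "kernel G H h \<noteq> {\<one>}"
  shows "card (carrier H) < card (carrier G)"
proof (rule ccontr)
  assume "\<not> ?thesis"
  then have "card (h ` carrier G) = card (carrier G)"
    using assms card_image_le[of "carrier G" h] by simp
  then have "inj_on h (carrier G)" using assms by (simp add: eq_card_imp_inj_on)
  then show False using assms inj_iff_trivial_ker by blast
qed

section \<open>Tuples congruent modulo the derived subgroup\<close>

context group
begin

lemma derived_trivial_if_commuting:
  assumes "\<And>a b. a \<in> carrier G \<Longrightarrow> b \<in> carrier G \<Longrightarrow> a \<otimes> b = b \<otimes> a"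
  shows "derived G (carrier G) = {\<one>}"
  using comm_group.derived_eq_singleton[OF group_comm_groupI] assms by blast

lemma congruent_mod_trivial:
  assumes "list_all2 (\<lambda>x y. (x, y) \<in> rcong {\<one>}) xs ys"
  shows "xs = ys"
proof -
  have eq: "x = y" if xy: "(x, y) \<in> rcong {\<one>}" for x y
  proof -
    have c: "x \<in> carrier G" "y \<in> carrier G" "inv x \<otimes> y = \<one>"
      using xy by (auto simp: r_congruent_def)
    then have "x \<otimes> (inv x \<otimes> y) = x" by simp
    then show ?thesis using mult_inv_cancel_left(1)[OF c(1,2)] by simp
  qed
  have "list_all2 (=) xs ys" using assms by (rule list.rel_mono_strong) (rule eq)
  then show ?thesis by (simp add: list.rel_eq)
qed

lemma exists_minimal_normal_AC_step:
  assumes fin: "finite (carrier G)" and k: "k \<ge> 2"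
    and xs: "xs \<in> normal_generating_tuples G k"
    and nonabelian: "a \<in> carrier G" "b \<in> carrier G" "a \<otimes> b \<noteq> b \<otimes> a"
  obtains L where "minimal_normal G L" "L \<subseteq> derived G (carrier G)"
    "\<And>ys. ys \<in> normal_generating_tuples G k \<Longrightarrow>
      list_all2 (\<lambda>x y. (x, y) \<in> rcong L) xs ys \<Longrightarrow> AC_equivalent G xs ys"
proof (cases "\<exists>L g l. minimal_normal G L \<and> L \<subseteq> derived G (carrier G) \<and>
    g \<in> carrier G \<and> l \<in> L \<and> g \<otimes> l \<noteq> l \<otimes> g")
  case True
  then obtain L g l where L: "minimal_normal G L" "L \<subseteq> derived G (carrier G)"
    and nc: "g \<in> carrier G" "l \<in> L" "g \<otimes> l \<noteq> l \<otimes> g" by blast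
  show thesis
    by (rule that[OF L AC_equivalent_mod_noncentral_minimal_normal[OF L(1) nc k xs]])
next
  case False
  show thesis
  proof (rule AC_equivalent_mod_some_central_subgroup[OF fin _ k xs nonabelian])
    fix L g l assume "minimal_normal G L" "L \<subseteq> derived G (carrier G)" "g \<in> carrier G" "l \<in> L"
    then show "g \<otimes> l = l \<otimes> g" using False by blast
  next
    fix L assume "minimal_normal G L" "L \<subseteq> derived G (carrier G)"
      "\<And>ys. list_all2 (\<lambda>x y. (x, y) \<in> rcong L) xs ys \<Longrightarrow> AC_equivalent G xs ys"
    then show thesis by (rule that)
  qed
qed

end

text \<open>Take \<open>L\<close> from \<open>exists_minimal_normal_AC_step\<close> for \<open>xs\<close>. By induction the images of \<open>ys\<close> and \<open>xs\<close> in \<open>G/L\<close>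
  are equivalent; lifting the moves that lead from \<open>ys\<close> to \<open>xs\<close> there ends in a tuple congruent to
  \<open>xs\<close> modulo \<open>L\<close>. The direction matters, because \<open>L\<close> is adapted to \<open>xs\<close>.\<close>

theorem AC_equivalent_if_congruent_mod_derived:
  fixes G :: "('a, 'b) monoid_scheme"
  assumes "group G" "finite (carrier G)" "k \<ge> 2"
    and "xs \<in> normal_generating_tuples G k" "ys \<in> normal_generating_tuples G k"
    and "list_all2 (\<lambda>x y. (x, y) \<in> rcong\<^bsub>G\<^esub> (derived G (carrier G))) xs ys"
  shows "AC_equivalent G xs ys"
  using assms
proof (induction "card (carrier G)" arbitrary: G xs ys rule: less_induct)
  case less
  interpret group G by (rule less.prems)
  note xs = less.prems(4) and ys = less.prems(5)
  have xsc: "set xs \<subseteq> carrier G" and ysc: "set ys \<subseteq> carrier G"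
    using xs ys by (auto simp: normal_generating_tuples_def)
  show ?case
  proof (cases "\<exists>a\<in>carrier G. \<exists>b\<in>carrier G. a \<otimes>\<^bsub>G\<^esub> b \<noteq> b \<otimes>\<^bsub>G\<^esub> a")
    case False
    then have "derived G (carrier G) = {\<one>\<^bsub>G\<^esub>}" by (intro derived_trivial_if_commuting) auto
    then show ?thesis using less.prems(6) congruent_mod_trivial AC_equivalent_refl by metis
  next
    case True
    then obtain L where L: "minimal_normal G L" "L \<subseteq> derived G (carrier G)"
      and step: "\<And>zs. zs \<in> normal_generating_tuples G k \<Longrightarrow>
        list_all2 (\<lambda>x y. (x, y) \<in> rcong\<^bsub>G\<^esub> L) xs zs \<Longrightarrow> AC_equivalent G xs zs"
      using exists_minimal_normal_AC_step[OF less.prems(2,3) xs] by metis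
    obtain Q :: "('a, 'b) monoid_scheme" and h where "group_hom G Q h"
      and surj: "h ` carrier G = carrier Q" and ker: "kernel G Q h = L"
      using quotient_on_representatives L by (metis minimal_normal_def)
    interpret h: group_hom G Q h by fact
    have "AC_equivalent Q (map h ys) (map h xs)"
    proof (rule h.H.AC_equivalent_sym)
      show "AC_equivalent Q (map h xs) (map h ys)"
      proof (rule less.hyps)
        show "card (carrier Q) < card (carrier G)"
          using h.card_image_less[OF less.prems(2) surj] ker L by (simp add: minimal_normal_def)
        show "finite (carrier Q)" using surj less.prems(2) by (metis finite_imageI)
        show "list_all2 (\<lambda>x y. (x, y) \<in> rcong\<^bsub>Q\<^esub> (derived Q (carrier Q))) (map h xs) (map h ys)"
          using h.congruent_map[OF less.prems(6)] h.derived_image[OF surj] by simp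
      qed (use h.map_normal_generating[OF surj] xs ys h.H.is_group less.prems(3) in auto)
    qed (use xsc in auto)
    then obtain zs where zs: "AC_equivalent G ys zs"
      "list_all2 (\<lambda>x y. (x, y) \<in> rcong\<^bsub>G\<^esub> L) xs zs"
      using h.AC_equivalent_lift_mod_kernel[OF surj _ ysc xsc] ker by metis
    have "AC_equivalent G xs zs" using step AC_equivalent_normal_generating[OF zs(1) ys] zs(2) by blast
    also have "AC_equivalent G zs ys" using zs(1) ysc by (rule AC_equivalent_sym)
    finally show ?thesis .
  qed
qed

section \<open>Lifting generating tuples of the abelianisation\<close>

context group
begin

text \<open>In \<open>G/M\<close> the image of \<open>X\<close> is central and normally generates the group, so \<open>G/M\<close> is abelian.\<close>

lemma derived_subset_if_central_supplement:
  assumes M: "M \<lhd> G" and X: "X \<subseteq> carrier G"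
    and gen: "normal_closure G (M \<union> X) = carrier G"
    and central: "\<And>g x. g \<in> carrier G \<Longrightarrow> x \<in> X \<Longrightarrow> x \<otimes> g = g \<otimes> x"
  shows "derived G (carrier G) \<subseteq> M"
proof -
  obtain Q :: "('a, 'b) monoid_scheme" and h where "group_hom G Q h"
    and surj: "h ` carrier G = carrier Q" and ker: "kernel G Q h = M"
    using quotient_on_representatives M by metis
  interpret h: group_hom G Q h by fact
  let ?C = "{q \<in> carrier Q. \<forall>s\<in>carrier Q. q \<otimes>\<^bsub>Q\<^esub> s = s \<otimes>\<^bsub>Q\<^esub> q}"
  have C: "?C \<lhd> Q" by (rule h.H.centraliser_normal) auto
  have MX: "M \<union> X \<subseteq> carrier G" using X normal_subset_carrier[OF M] by blast
  have "h ` (M \<union> X) \<subseteq> ?C"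
  proof
    fix q assume "q \<in> h ` (M \<union> X)"
    then obtain x where x: "x \<in> M \<union> X" "q = h x" by blast
    have xc: "x \<in> carrier G" using x MX by blast
    have "q \<otimes>\<^bsub>Q\<^esub> s = s \<otimes>\<^bsub>Q\<^esub> q" if "s \<in> carrier Q" for s
    proof (cases "x \<in> M")
      case True
      then have "q = \<one>\<^bsub>Q\<^esub>" using ker x by (auto simp: kernel_def)
      then show ?thesis using that by simp
    next
      case False
      have "s \<in> h ` carrier G" using that surj by simp
      then obtain g where g: "g \<in> carrier G" "s = h g" by auto
      have "x \<in> X" using x False by blast
      then have "h (x \<otimes> g) = h (g \<otimes> x)" by (simp only: central[OF g(1)])
      then show ?thesis using g x xc by simp
    qed
    then show "q \<in> ?C" using x xc by simp
  qed
  then have "normal_closure Q (h ` (M \<union> X)) \<subseteq> ?C" by (rule h.H.normal_closure_least[OF C])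
  then have "carrier Q \<subseteq> ?C" unfolding h.image_normal_closure_eq_carrier[OF surj MX gen] .
  then have "derived Q (carrier Q) = {\<one>\<^bsub>Q\<^esub>}" by (intro h.H.derived_trivial_if_commuting) blast
  then have "h ` derived G (carrier G) = {\<one>\<^bsub>Q\<^esub>}" using h.derived_image[OF surj] by simp
  then show ?thesis using ker derived_in_carrier[of "carrier G"] by (auto simp: kernel_def)
qed

end

text \<open>Let \<open>L \<le> G'\<close> be minimal normal. By induction the tuple can be corrected to \<open>ys\<close> that normally
  generates \<open>G\<close> modulo \<open>L\<close>. Let \<open>M\<close> be its normal closure. If \<open>L\<close> is not contained in \<open>M\<close>, then \<open>L\<close> and
  \<open>M\<close> commute. Here \<open>L\<close> is not abelian: otherwise it would be central, \<open>G/M\<close> would be abelian, and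
  \<open>L \<le> G' \<le> M\<close>. So multiply the first component by some \<open>a \<in> L\<close> that does not commute with some
  \<open>b \<in> L\<close>: the result does not commute with \<open>b\<close>, hence has \<open>L\<close> in its normal closure.\<close>

theorem normal_generating_tuple_lift:
  fixes G :: "('a, 'b) monoid_scheme"
  assumes "group G" "finite (carrier G)" "xs \<noteq> []" "set xs \<subseteq> carrier G"
    and "normal_closure G (set xs \<union> derived G (carrier G)) = carrier G"
  shows "\<exists>ys. list_all2 (\<lambda>x y. (x, y) \<in> rcong\<^bsub>G\<^esub> (derived G (carrier G))) xs ys \<and>
    ys \<in> normal_generating_tuples G (length xs)"
  using assms
proof (induction "card (carrier G)" arbitrary: G xs rule: less_induct)
  case less
  interpret group G by (rule less.prems)
  let ?D = "derived G (carrier G)"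
  note xsc = less.prems(4)
  interpret D: normal ?D G by (rule derived_self_is_normal)
  show ?case
  proof (cases "?D = {\<one>\<^bsub>G\<^esub>}")
    case True
    let ?N = "normal_closure G (set xs)"
    have N: "?N \<lhd> G" using xsc by (rule normal_closure_normal)
    have "normal_closure G (set xs \<union> ?D) \<subseteq> ?N"
      using subset_normal_closure[of "set xs"] subgroup.one_closed[OF normal_imp_subgroup[OF N]] True
      by (intro normal_closure_least[OF N]) auto
    then have "?N = carrier G" using less.prems(5) normal_subset_carrier[OF N] by auto
    moreover have "list_all2 (\<lambda>x y. (x, y) \<in> rcong\<^bsub>G\<^esub> ?D) xs xs"
      using xsc D.one_closed subsetD[OF xsc nth_mem]
      by (intro list_all2_all_nthI) (auto simp: r_congruent_def)
    ultimately show ?thesis using xsc by (auto simp: normal_generating_tuples_def)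
  next
    case False
    obtain L where L: "minimal_normal G L" "L \<subseteq> ?D"
      using minimal_normal_exists[OF less.prems(2) D.normal_axioms False] .
    have LN: "L \<lhd> G" "L \<noteq> {\<one>\<^bsub>G\<^esub>}" using L by (auto simp: minimal_normal_def)
    interpret L: normal L G by (rule LN)
    obtain Q :: "('a, 'b) monoid_scheme" and h where "group_hom G Q h"
      and surj: "h ` carrier G = carrier Q" and ker: "kernel G Q h = L"
      using quotient_on_representatives LN(1) by metis
    interpret h: group_hom G Q h by fact
    have "\<exists>ws. list_all2 (\<lambda>x y. (x, y) \<in> rcong\<^bsub>Q\<^esub> (derived Q (carrier Q))) (map h xs) ws \<and>
        ws \<in> normal_generating_tuples Q (length (map h xs))"
    proof (rule less.hyps)
      show "card (carrier Q) < card (carrier G)"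
        using h.card_image_less[OF less.prems(2) surj] ker LN by simp
      show "finite (carrier Q)" using surj less.prems(2) by (metis finite_imageI)
      have "normal_closure Q (h ` (set xs \<union> ?D)) = carrier Q"
        using xsc D.subset less.prems(5) by (intro h.image_normal_closure_eq_carrier[OF surj]) auto
      then show "normal_closure Q (set (map h xs) \<union> derived Q (carrier Q)) = carrier Q"
        using h.derived_image[OF surj] by (simp add: image_Un)
    qed (use xsc h.H.is_group less.prems(3) in auto)
    then obtain ws where ws: "ws \<in> normal_generating_tuples Q (length xs)"
      and cong_ws: "list_all2 (\<lambda>x y. (x, y) \<in> rcong\<^bsub>Q\<^esub> (h ` ?D)) (map h xs) ws"
      using h.derived_image[OF surj] by auto
    obtain ys where ys: "map h ys = ws" and cong: "list_all2 (\<lambda>x y. (x, y) \<in> rcong\<^bsub>G\<^esub> ?D) xs ys"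
      using h.congruent_lift[OF surj D.normal_axioms xsc cong_ws] .
    have len: "length ys = length xs" using cong by (simp add: list_all2_lengthD)
    have ysc: "set ys \<subseteq> carrier G"
      using cong by (auto simp: list_all2_conv_all_nth r_congruent_def in_set_conv_nth)
    have full: "normal_closure G (set zs) = carrier G"
      if "map h zs = ws" "set zs \<subseteq> carrier G" "L \<subseteq> normal_closure G (set zs)" for zs
      using that ws ker subset_normal_closure
      by (intro h.normal_eq_carrier_if_map_generates[OF surj, of zs "length xs"] normal_closure_normal) auto
    let ?M = "normal_closure G (set ys)"
    have M: "?M \<lhd> G" using ysc by (rule normal_closure_normal)
    show ?thesis
    proof (cases "L \<subseteq> ?M")
      case True
      then show ?thesis using full[OF ys ysc] cong ysc len by (auto simp: normal_generating_tuples_def)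
    next
      case False
      have comm: "x \<otimes>\<^bsub>G\<^esub> l = l \<otimes>\<^bsub>G\<^esub> x" if "x \<in> ?M" "l \<in> L" for x l
        using minimal_normal_subset_of_noncommuting[OF L(1) M] that False by blast
      have gen: "N = carrier G" if "N \<lhd> G" "set ys \<subseteq> N" "L \<subseteq> N" for N
        using h.normal_eq_carrier_if_map_generates[OF surj _ that(1) _ that(2)] ys ws ker that(3) by simp
      obtain a b where ab: "a \<in> L" "b \<in> L" "a \<otimes>\<^bsub>G\<^esub> b \<noteq> b \<otimes>\<^bsub>G\<^esub> a"
      proof (rule ccontr)
        assume neg: "\<not> thesis"
        let ?C = "{g \<in> carrier G. \<forall>n\<in>L. g \<otimes>\<^bsub>G\<^esub> n = n \<otimes>\<^bsub>G\<^esub> g}"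
        have "set ys \<subseteq> ?C" using comm ysc subset_normal_closure[of "set ys"] by auto
        moreover have "L \<subseteq> ?C" using neg that by auto
        ultimately have C: "?C = carrier G" using gen normal_centraliser_normal[OF LN(1)] by blast
        have central: "l \<otimes>\<^bsub>G\<^esub> g = g \<otimes>\<^bsub>G\<^esub> l" if "g \<in> carrier G" "l \<in> L" for g l
        proof -
          have "g \<in> ?C" unfolding C by (rule that)
          then show ?thesis using that by simp
        qed
        have sub: "?M \<union> L \<subseteq> normal_closure G (?M \<union> L)" by (rule subset_normal_closure)
        have "normal_closure G (?M \<union> L) = carrier G"
          using sub subset_normal_closure[of "set ys"] normal_subset_carrier[OF M] L.subset
          by (intro gen normal_closure_normal) auto
        then have "?D \<subseteq> ?M"
          using central by (rule derived_subset_if_central_supplement[OF M L.subset])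
        then show False using L False by blast
      qed
      have y0: "ys ! 0 \<in> set ys" using less.prems(3) len by simp
      have c: "ys ! 0 \<in> carrier G" "a \<in> carrier G" "b \<in> carrier G" using y0 ysc ab by auto
      let ?z = "ys ! 0 \<otimes>\<^bsub>G\<^esub> a"
      let ?zs = "ys[0 := ?z]"
      have zsc: "set ?zs \<subseteq> carrier G" using ysc c by (intro set_update_subsetI) auto
      have "h a = \<one>\<^bsub>Q\<^esub>" using ab(1) ker by (auto simp: kernel_def)
      then have "h ?z = map h ys ! 0" using c less.prems(3) len by simp
      then have "map h ?zs = ws" unfolding map_update using ys by (metis list_update_id)
      moreover have "L \<subseteq> normal_closure G (set ?zs)"
      proof (rule minimal_normal_subset_of_noncommuting[OF L(1) normal_closure_normal[OF zsc]])
        show "?z \<in> normal_closure G (set ?zs)"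
          using subset_normal_closure[of "set ?zs"] less.prems(3) len set_update_memI[of 0 ys ?z] by auto
        show "?z \<otimes>\<^bsub>G\<^esub> b \<noteq> b \<otimes>\<^bsub>G\<^esub> ?z"
        proof
          assume eq: "?z \<otimes>\<^bsub>G\<^esub> b = b \<otimes>\<^bsub>G\<^esub> ?z"
          have "ys ! 0 \<otimes>\<^bsub>G\<^esub> (a \<otimes>\<^bsub>G\<^esub> b) = b \<otimes>\<^bsub>G\<^esub> ys ! 0 \<otimes>\<^bsub>G\<^esub> a"
            using eq c by (simp add: m_assoc)
          also have "b \<otimes>\<^bsub>G\<^esub> ys ! 0 = ys ! 0 \<otimes>\<^bsub>G\<^esub> b"
            using comm[of "ys ! 0" b] y0 subset_normal_closure[of "set ys"] ab by auto
          also have "ys ! 0 \<otimes>\<^bsub>G\<^esub> b \<otimes>\<^bsub>G\<^esub> a = ys ! 0 \<otimes>\<^bsub>G\<^esub> (b \<otimes>\<^bsub>G\<^esub> a)"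
            using c by (simp add: m_assoc)
          finally show False using ab c by simp
        qed
      qed (rule ab)
      ultimately have "normal_closure G (set ?zs) = carrier G" using full zsc by blast
      moreover have "list_all2 (\<lambda>x y. (x, y) \<in> rcong\<^bsub>G\<^esub> ?D) xs ?zs"
      proof (rule list_all2_all_nthI)
        fix i assume i: "i < length xs"
        have nth: "(xs ! i, ys ! i) \<in> rcong\<^bsub>G\<^esub> ?D" using cong i by (simp add: list_all2_conv_all_nth)
        show "(xs ! i, ?zs ! i) \<in> rcong\<^bsub>G\<^esub> ?D"
        proof (cases "i = 0")
          case True
          have x: "xs ! 0 \<in> carrier G" "inv\<^bsub>G\<^esub> (xs ! 0) \<otimes>\<^bsub>G\<^esub> ys ! 0 \<in> ?D"
            using nth True by (auto simp: r_congruent_def)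
          have "inv\<^bsub>G\<^esub> (xs ! 0) \<otimes>\<^bsub>G\<^esub> ys ! 0 \<otimes>\<^bsub>G\<^esub> a \<in> ?D"
            by (rule D.m_closed[OF x(2) subsetD[OF L(2) ab(1)]])
          then show ?thesis using True i len x c by (simp add: r_congruent_def m_assoc)
        qed (use nth in simp)
      qed (simp add: len)
      ultimately show ?thesis using zsc len by (auto simp: normal_generating_tuples_def)
    qed
  qed
qed

section \<open>Components of the Andrews--Curtis graph\<close>

text \<open>Vertices cannot leave the graph along moves, and every move can be undone, so reachability in the
  graph is the equivalence of tuples.\<close>

lemma (in group) AC_components_eq:
  "AC_components G k =
     {{V \<in> normal_generating_tuples G k. AC_equivalent G U V} | U. U \<in> normal_generating_tuples G k}"
proof -
  let ?N = "normal_generating_tuples G k"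
  let ?D = "with_proj (AC_graph G k)"
  have carr: "set U \<subseteq> carrier G" if "U \<in> ?N" for U
    using that by (simp add: normal_generating_tuples_def)
  have verts: "verts ?D = ?N" by (simp add: AC_graph_def)
  have ends: "arcs_ends ?D = {(U, V). U \<in> ?N \<and> V \<in> ?N \<and> AC_move G U V}"
    using AC_move_sym carr by (auto simp: arcs_ends_conv AC_graph_def image_iff)
  interpret D: wf_digraph ?D by unfold_locales (auto simp: AC_graph_def)
  have reach: "U \<rightarrow>\<^sup>*\<^bsub>?D\<^esub> V \<longleftrightarrow> U \<in> ?N \<and> AC_equivalent G U V" for U V
  proof
    assume "U \<rightarrow>\<^sup>*\<^bsub>?D\<^esub> V"
    then show "U \<in> ?N \<and> AC_equivalent G U V"
    proof (induction rule: D.reachable_induct)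
      case base
      then show ?case using verts AC_equivalent_refl by blast
    next
      case (step x y)
      then show ?case using ends AC_equivalent_trans AC_move_imp_equivalent by blast
    qed
  next
    assume UV: "U \<in> ?N \<and> AC_equivalent G U V"
    then have "(AC_move G)\<^sup>*\<^sup>* U V" by (simp add: AC_equivalent_def)
    then have "U \<rightarrow>\<^sup>*\<^bsub>?D\<^esub> V \<and> V \<in> ?N"
    proof (induction rule: rtranclp_induct)
      case base
      then show ?case using UV verts by (simp add: reachable_def)
    next
      case (step x y)
      then have "y \<in> ?N" using AC_move_normal_generating by blast
      then show ?case using step ends D.reachable_adj_trans by blast
    qed
    then show "U \<rightarrow>\<^sup>*\<^bsub>?D\<^esub> V" by blast
  qed
  have "D.scc_of U = {V \<in> ?N. AC_equivalent G U V}" if "U \<in> ?N" for U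
    using that reach AC_equivalent_sym[OF _ carr[OF that]]
    by (auto simp: D.scc_of_def intro: AC_equivalent_normal_generating)
  then show ?thesis
    unfolding AC_components_def D.sccs_verts_conv_scc_of verts by auto
qed

lemma (in group) abelianisation_group_hom:
  "group_hom G (abelianisation G) (abelianisation_map G)"
  "abelianisation_map G ` carrier G = carrier (abelianisation G)"
  "kernel G (abelianisation G) (abelianisation_map G) = derived G (carrier G)"
proof -
  interpret D: normal "derived G (carrier G)" G by (rule derived_self_is_normal)
  have map: "abelianisation_map G = (\<lambda>x. derived G (carrier G) #> x)"
    by (simp add: abelianisation_map_def fun_eq_iff)
  show "group_hom G (abelianisation G) (abelianisation_map G)"
    unfolding abelianisation_def map
    by (intro group_hom.intro group_hom_axioms.intro D.factorgroup_is_group D.r_coset_hom_Mod) (rule is_group)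
  show "abelianisation_map G ` carrier G = carrier (abelianisation G)"
    unfolding abelianisation_def map by (auto simp: FactGroup_def RCOSETS_def)
  have "derived G (carrier G) #> x = derived G (carrier G) \<longleftrightarrow> x \<in> derived G (carrier G)"
    if "x \<in> carrier G" for x
    using that coset_join1 coset_join2 D.subgroup_axioms by blast
  then show "kernel G (abelianisation G) (abelianisation_map G) = derived G (carrier G)"
    using D.subset unfolding abelianisation_def map by (auto simp: kernel_def FactGroup_def)
qed

text \<open>With \<open>p\<close> the map to \<open>Ab(G)\<close> on tuples, the first part says that the class of \<open>U\<close> is the preimage of
  the class of \<open>p U\<close>. The second part then needs only that \<open>p\<close> maps \<open>N\<^sub>k(G)\<close> onto \<open>N\<^sub>k(Ab(G))\<close>.\<close>

theorem theorem1p1: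
  fixes G :: "('a, 'b) monoid_scheme" and k :: nat
  assumes "group G" and "finite (carrier G)" and "k \<ge> max (normal_rank G) 2"
  shows "(\<forall>U \<in> normal_generating_tuples G k. \<forall>V \<in> normal_generating_tuples G k.
            AC_equivalent G U V \<longleftrightarrow>
            AC_equivalent (abelianisation G)
              (map (abelianisation_map G) U) (map (abelianisation_map G) V))
       \<and> AC_components G k =
           {{U \<in> normal_generating_tuples G k. map (abelianisation_map G) U \<in> C} | C.
              C \<in> AC_components (abelianisation G) k}"
proof -
  interpret group G by (rule assms)
  let ?A = "abelianisation G" and ?p = "abelianisation_map G" and ?D = "derived G (carrier G)"
  let ?N = "normal_generating_tuples G k" and ?NA = "normal_generating_tuples (abelianisation G) k"
  note surj = abelianisation_group_hom(2) and ker = abelianisation_group_hom(3)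
  interpret p: group_hom G ?A ?p by (rule abelianisation_group_hom)
  have k: "k \<ge> 2" using assms(3) by simp
  have carr: "set U \<subseteq> carrier G" if "U \<in> ?N" for U
    using that by (simp add: normal_generating_tuples_def)
  have equiv: "AC_equivalent G U V \<longleftrightarrow> AC_equivalent ?A (map ?p U) (map ?p V)"
    if U: "U \<in> ?N" and V: "V \<in> ?N" for U V
  proof
    assume "AC_equivalent G U V"
    then show "AC_equivalent ?A (map ?p U) (map ?p V)" using carr[OF U] by (rule p.AC_equivalent_map)
  next
    assume "AC_equivalent ?A (map ?p U) (map ?p V)"
    then obtain Z where Z: "AC_equivalent G U Z" "list_all2 (\<lambda>x y. (x, y) \<in> rcong\<^bsub>G\<^esub> ?D) V Z"
      using p.AC_equivalent_lift_mod_kernel[OF surj _ carr[OF U] carr[OF V]] ker by metis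
    have "Z \<in> ?N" using AC_equivalent_normal_generating[OF Z(1) U] .
    then have "AC_equivalent G V Z"
      using AC_equivalent_if_congruent_mod_derived[OF is_group assms(2) k V _ Z(2)] by simp
    then have "AC_equivalent G Z V" using carr[OF V] by (rule AC_equivalent_sym)
    with Z(1) show "AC_equivalent G U V" by (rule AC_equivalent_trans)
  qed
  have lift: "\<exists>U\<in>?N. map ?p U = W" if W: "W \<in> ?NA" for W
  proof -
    have "set W \<subseteq> ?p ` carrier G" using W surj by (auto simp: normal_generating_tuples_def)
    then have "W \<in> map ?p ` lists (carrier G)" by (auto simp flip: lists_image)
    then obtain X where X: "set X \<subseteq> carrier G" "W = map ?p X" by auto
    let ?Y = "set X \<union> ?D"
    have "?Y \<subseteq> carrier G" using X derived_in_carrier by blast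
    then have "normal_closure G ?Y = carrier G"
      using p.normal_eq_carrier_if_map_generates[OF surj, of X k "normal_closure G ?Y"]
        W X ker normal_closure_normal subset_normal_closure[of ?Y] by auto
    moreover have len: "length X = k" using W X by (simp add: normal_generating_tuples_def)
    moreover have "X \<noteq> []" using len k by auto
    ultimately obtain U where U: "list_all2 (\<lambda>x y. (x, y) \<in> rcong\<^bsub>G\<^esub> ?D) X U" "U \<in> ?N"
      using normal_generating_tuple_lift[OF is_group assms(2) _ X(1)] by blast
    have "map ?p X = map ?p U" using U(1) p.map_eq_if_congruent_mod_kernel ker by simp
    then show ?thesis using U X by metis
  qed
  have map: "map ?p U \<in> ?NA" if "U \<in> ?N" for U using p.map_normal_generating[OF surj that] .
  let ?F = "\<lambda>W. {V \<in> ?N. map ?p V \<in> {W' \<in> ?NA. AC_equivalent ?A W W'}}"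
  have "AC_components G k = (\<lambda>U. {V \<in> ?N. AC_equivalent G U V}) ` ?N"
    by (simp only: AC_components_eq setcompr_eq_image Collect_mem_eq)
  also have "\<dots> = (\<lambda>U. ?F (map ?p U)) ` ?N"
    using equiv map by (intro image_cong) auto
  also have "\<dots> = ?F ` (map ?p ` ?N)" by (simp only: image_image)
  also have "map ?p ` ?N = ?NA" using lift map by blast
  also have "?F ` ?NA = {{V \<in> ?N. map ?p V \<in> C} | C. C \<in> AC_components ?A k}"
    unfolding p.H.AC_components_eq by blast
  finally show ?thesis using equiv by blast
qed

end
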